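(* Let $(M^n,g,f)$ be an $n$-dimensional compact Miao-Tam critical metric with zero scalar curvature whose boundary is isometric to a standard sphere $\mathbb{S}^{n-1}(r)$ of radius $r$, and let $f_{\max}$ be the maximum value of $f$ on $M$. If $r>\sqrt{2(n-1)f_{\max}}$, then $(M^n,g)$ cannot be isometric to a geodesic ball in the simply connected space form $\mathbb{R}^n$.
   Context: A (compact) Miao-Tam critical metric $(M^n,g,f)$ is a connected compact Riemannian manifold $(M^n,g)$ with smooth boundary $\partial M$ together with a nonnegative smooth function $f$ on $M$ such that $f^{-1}(0)=\partial M$ and $$-(\Delta f)g+\mathrm{Hess}\,f-f\,\mathrm{Ric}=g .$$ For such a metric the scalar curvature is constant. *)

theory Defs
  imports "HOL-Analysis.Analysis"
begin

text \<open>
  The partial derivative at \<open>x\<close> in direction \<open>i\<close> is taken along those points of the coordinate line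
  through \<open>x\<close> that lie in \<open>S\<close>. On relatively open subsets of a half-space it is one-sided in the
  normal direction at boundary points and the usual partial derivative otherwise.
\<close>

definition partial_deriv ::
  "(real^'n) set \<Rightarrow> 'n::finite \<Rightarrow> (real^'n \<Rightarrow> 'b::real_normed_vector) \<Rightarrow> real^'n \<Rightarrow> 'b" where
  "partial_deriv S i h x =
     vector_derivative (\<lambda>t. h (x + t *\<^sub>R axis i 1)) (at 0 within {t. x + t *\<^sub>R axis i 1 \<in> S})"

primrec C_k_on ::
  "nat \<Rightarrow> (real^'n::finite) set \<Rightarrow> (real^'n \<Rightarrow> 'b::real_normed_vector) \<Rightarrow> bool" where
  "C_k_on 0 V h \<longleftrightarrow> continuous_on V h"
| "C_k_on (Suc k) V h \<longleftrightarrow> h differentiable_on V \<and> (\<forall>i. C_k_on k V (partial_deriv V i h))"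

text \<open>
  \<open>C_k_on\<close> is only meant for open sets. Smoothness on an arbitrary set \<open>S\<close> means that locally there
  is a smooth extension to an open subset of the ambient space.
\<close>

definition smooth_on ::
  "(real^'n::finite) set \<Rightarrow> (real^'n \<Rightarrow> 'b::real_normed_vector) \<Rightarrow> bool" where
  "smooth_on S h \<longleftrightarrow>
     (\<forall>x\<in>S. \<exists>V e. open V \<and> x \<in> V \<and> (\<forall>k. C_k_on k V e) \<and> (\<forall>y\<in>S \<inter> V. e y = h y))"

text \<open>Since \<open>'n\<close> carries no distinguished index, one is fixed arbitrarily as the normal direction.\<close>

definition normal_index :: "'n::finite" where
  "normal_index = (SOME i. True)"

definition half_space :: "(real^'n::finite) set" where
  "half_space = {x. 0 \<le> x $ normal_index}"

text \<open>A chart is a pair of a domain and a coordinate map into the closed half-space.\<close>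

type_synonym ('a, 'n) chart = "'a set \<times> ('a \<Rightarrow> real^'n)"

definition chart_image :: "('a, 'n::finite) chart \<Rightarrow> (real^'n) set" where
  "chart_image c = snd c ` fst c"

definition chart_inv :: "('a, 'n::finite) chart \<Rightarrow> real^'n \<Rightarrow> 'a" where
  "chart_inv c = inv_into (fst c) (snd c)"

definition is_chart :: "'a topology \<Rightarrow> ('a, 'n::finite) chart \<Rightarrow> bool" where
  "is_chart X c \<longleftrightarrow>
     openin X (fst c) \<and>
     openin (top_of_set half_space) (chart_image c) \<and>
     homeomorphic_map (subtopology X (fst c)) (top_of_set (chart_image c)) (snd c)"

definition overlap :: "('a, 'n::finite) chart \<Rightarrow> ('a, 'n) chart \<Rightarrow> (real^'n) set" where
  "overlap c d = snd c ` (fst c \<inter> fst d)"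

definition transition :: "('a, 'n::finite) chart \<Rightarrow> ('a, 'n) chart \<Rightarrow> real^'n \<Rightarrow> real^'n" where
  "transition c d = snd d \<circ> chart_inv c"

definition smooth_manifold_with_boundary ::
  "'a topology \<Rightarrow> ('a, 'n::finite) chart set \<Rightarrow> bool" where
  "smooth_manifold_with_boundary X A \<longleftrightarrow>
     Hausdorff_space X \<and> second_countable X \<and>
     (\<forall>c\<in>A. is_chart X c) \<and>
     (\<Union>c\<in>A. fst c) = topspace X \<and>
     (\<forall>c\<in>A. \<forall>d\<in>A. smooth_on (overlap c d) (transition c d))"

definition manifold_boundary ::
  "'a topology \<Rightarrow> ('a, 'n::finite) chart set \<Rightarrow> 'a set" where
  "manifold_boundary X A =
     {p \<in> topspace X. \<exists>c\<in>A. p \<in> fst c \<and> snd c p $ normal_index = 0}"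

definition smooth_function :: "('a, 'n::finite) chart set \<Rightarrow> ('a \<Rightarrow> real) \<Rightarrow> bool" where
  "smooth_function A f \<longleftrightarrow> (\<forall>c\<in>A. smooth_on (chart_image c) (f \<circ> chart_inv c))"

text \<open>
  A metric is given by its component matrices in each chart, which are related by the
  transformation law of a covariant 2-tensor.
\<close>

type_synonym ('a, 'n) metric = "('a, 'n) chart \<Rightarrow> real^'n \<Rightarrow> real^'n^'n"

definition riemannian_metric ::
  "('a, 'n::finite) chart set \<Rightarrow> ('a, 'n) metric \<Rightarrow> bool" where
  "riemannian_metric A g \<longleftrightarrow>
     (\<forall>c\<in>A. smooth_on (chart_image c) (g c)) \<and>
     (\<forall>c\<in>A. \<forall>x\<in>chart_image c.
        transpose (g c x) = g c x \<and> (\<forall>v. v \<noteq> 0 \<longrightarrow> 0 < v \<bullet> (g c x *v v))) \<and>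
     (\<forall>c\<in>A. \<forall>d\<in>A. \<forall>x\<in>overlap c d. \<forall>i j.
        g c x $ i $ j =
          (\<Sum>k\<in>UNIV. \<Sum>l\<in>UNIV.
             partial_deriv (overlap c d) i (transition c d) x $ k *
             partial_deriv (overlap c d) j (transition c d) x $ l *
             g d (transition c d x) $ k $ l))"

text \<open>
  In the following definitions \<open>S\<close> is a coordinate domain, \<open>G\<close> are the components of the metric
  on it, and \<open>h\<close> is the coordinate expression of a function.
\<close>

definition christoffel ::
  "(real^'n) set \<Rightarrow> (real^'n \<Rightarrow> real^'n^'n) \<Rightarrow> 'n::finite \<Rightarrow> 'n \<Rightarrow> 'n \<Rightarrow> real^'n \<Rightarrow> real" where
  "christoffel S G k i j x =
     (\<Sum>l\<in>UNIV. matrix_inv (G x) $ k $ l *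
        (partial_deriv S i (\<lambda>y. G y $ j $ l) x
         + partial_deriv S j (\<lambda>y. G y $ i $ l) x
         - partial_deriv S l (\<lambda>y. G y $ i $ j) x)) / 2"

text \<open>
  \<open>riemann S G l k i j\<close> is the \<open>l\<close>-th component of
  \<open>R(\<partial>\<^sub>i, \<partial>\<^sub>j)\<partial>\<^sub>k = \<nabla>\<^sub>i\<nabla>\<^sub>j\<partial>\<^sub>k - \<nabla>\<^sub>j\<nabla>\<^sub>i\<partial>\<^sub>k\<close>, and the Ricci tensor is the trace
  of \<open>X \<mapsto> R(X, \<partial>\<^sub>j)\<partial>\<^sub>k\<close>; with this convention round spheres have positive Ricci curvature.
\<close>

definition riemann ::
  "(real^'n) set \<Rightarrow> (real^'n \<Rightarrow> real^'n^'n) \<Rightarrow> 'n::finite \<Rightarrow> 'n \<Rightarrow> 'n \<Rightarrow> 'n \<Rightarrow> real^'n \<Rightarrow> real" where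
  "riemann S G l k i j x =
     partial_deriv S i (christoffel S G l j k) x
     - partial_deriv S j (christoffel S G l i k) x
     + (\<Sum>m\<in>UNIV. christoffel S G l i m x * christoffel S G m j k x
                  - christoffel S G l j m x * christoffel S G m i k x)"

definition ricci ::
  "(real^'n) set \<Rightarrow> (real^'n \<Rightarrow> real^'n^'n) \<Rightarrow> 'n::finite \<Rightarrow> 'n \<Rightarrow> real^'n \<Rightarrow> real" where
  "ricci S G j k x = (\<Sum>i\<in>UNIV. riemann S G i k i j x)"

definition scalar_curvature ::
  "(real^'n::finite) set \<Rightarrow> (real^'n \<Rightarrow> real^'n^'n) \<Rightarrow> real^'n \<Rightarrow> real" where
  "scalar_curvature S G x =
     (\<Sum>i\<in>UNIV. \<Sum>j\<in>UNIV. matrix_inv (G x) $ i $ j * ricci S G i j x)"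

definition hessian ::
  "(real^'n) set \<Rightarrow> (real^'n \<Rightarrow> real^'n^'n) \<Rightarrow> (real^'n \<Rightarrow> real) \<Rightarrow> 'n::finite \<Rightarrow> 'n \<Rightarrow> real^'n \<Rightarrow> real" where
  "hessian S G h i j x =
     partial_deriv S i (partial_deriv S j h) x
     - (\<Sum>k\<in>UNIV. christoffel S G k i j x * partial_deriv S k h x)"

definition laplacian ::
  "(real^'n::finite) set \<Rightarrow> (real^'n \<Rightarrow> real^'n^'n) \<Rightarrow> (real^'n \<Rightarrow> real) \<Rightarrow> real^'n \<Rightarrow> real" where
  "laplacian S G h x =
     (\<Sum>i\<in>UNIV. \<Sum>j\<in>UNIV. matrix_inv (G x) $ i $ j * hessian S G h i j x)"

definition zero_scalar_curvature ::
  "('a, 'n::finite) chart set \<Rightarrow> ('a, 'n) metric \<Rightarrow> bool" where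
  "zero_scalar_curvature A g \<longleftrightarrow>
     (\<forall>c\<in>A. \<forall>x\<in>chart_image c. scalar_curvature (chart_image c) (g c) x = 0)"

definition miao_tam_critical_metric ::
  "'a topology \<Rightarrow> ('a, 'n::finite) chart set \<Rightarrow> ('a, 'n) metric \<Rightarrow> ('a \<Rightarrow> real) \<Rightarrow> bool" where
  "miao_tam_critical_metric X A g f \<longleftrightarrow>
     smooth_manifold_with_boundary X A \<and> topspace X \<noteq> {} \<and>
     compact_space X \<and> connected_space X \<and>
     riemannian_metric A g \<and>
     smooth_function A f \<and>
     (\<forall>p\<in>topspace X. 0 \<le> f p) \<and>
     {p \<in> topspace X. f p = 0} = manifold_boundary X A \<and>
     (\<forall>c\<in>A. \<forall>x\<in>chart_image c. \<forall>i j.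
        - laplacian (chart_image c) (g c) (f \<circ> chart_inv c) x * g c x $ i $ j
        + hessian (chart_image c) (g c) (f \<circ> chart_inv c) i j x
        - f (chart_inv c x) * ricci (chart_image c) (g c) i j x
        = g c x $ i $ j)"

text \<open>
  \<open>D\<close> is a submanifold of the manifold, cut out in each chart so that the coordinate vectors with
  index in \<open>I\<close> span its tangent spaces. It carries the induced metric, and the submanifold \<open>N\<close> of
  Euclidean space carries the metric induced by the Euclidean one. The map \<open>F\<close> is required to
  be a diffeomorphism that pulls the latter metric back to the former.
\<close>

definition riemannian_isometry ::
  "'a topology \<Rightarrow> ('a, 'n::finite) chart set \<Rightarrow> ('a, 'n) metric \<Rightarrow> 'a set \<Rightarrow> 'n set \<Rightarrow>
   (real^'n) set \<Rightarrow> ('a \<Rightarrow> real^'n) \<Rightarrow> bool" where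
  "riemannian_isometry X A g D I N F \<longleftrightarrow>
     homeomorphic_map (subtopology X D) (top_of_set N) F \<and>
     (\<forall>c\<in>A. smooth_on (snd c ` (fst c \<inter> D)) (F \<circ> chart_inv c) \<and>
            smooth_on (F ` (fst c \<inter> D)) (snd c \<circ> inv_into D F)) \<and>
     (\<forall>c\<in>A. \<forall>x\<in>snd c ` (fst c \<inter> D). \<forall>i\<in>I. \<forall>j\<in>I.
        partial_deriv (snd c ` (fst c \<inter> D)) i (F \<circ> chart_inv c) x \<bullet>
        partial_deriv (snd c ` (fst c \<inter> D)) j (F \<circ> chart_inv c) x
        = g c x $ i $ j)"

definition isometric_to ::
  "'a topology \<Rightarrow> ('a, 'n::finite) chart set \<Rightarrow> ('a, 'n) metric \<Rightarrow> (real^'n) set \<Rightarrow> bool" where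
  "isometric_to X A g N \<longleftrightarrow> (\<exists>F. riemannian_isometry X A g (topspace X) UNIV N F)"

definition boundary_isometric_to ::
  "'a topology \<Rightarrow> ('a, 'n::finite) chart set \<Rightarrow> ('a, 'n) metric \<Rightarrow> (real^'n) set \<Rightarrow> bool" where
  "boundary_isometric_to X A g N \<longleftrightarrow>
     (\<exists>F. riemannian_isometry X A g (manifold_boundary X A) (UNIV - {normal_index}) N F)"

end

theory Submission
  imports Defs
begin

text \<open>
  Pull the potential back along an isometry with a flat ball of radius \<open>\<rho>\<close>. In flat coordinates the
  Ricci tensor vanishes, so tracing the critical equation gives \<open>Hess f = - g / (n - 1)\<close> (and a
  contradiction for \<open>n = 1\<close>). As \<open>f\<close> vanishes on the bounding sphere, its value at the centre is
  \<open>\<rho>\<^sup>2 / (2 (n - 1))\<close>, hence \<open>\<rho> \<le> sqrt (2 (n - 1) fmax)\<close>. The boundary is at the same time isometric to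
  the spheres of radii \<open>\<rho>\<close> and \<open>r\<close>. Any two points of the former are joined by an arc of length at
  most \<open>\<pi> \<rho>\<close>, while antipodal points of the latter cannot be joined by a curve shorter than \<open>\<pi> r\<close>;
  hence \<open>r \<le> \<rho>\<close>.
\<close>

section \<open>Partial derivatives on open sets\<close>

text \<open>The isometry with the ball and the isometry of the boundary with a round sphere are two
  unrelated maps, so \<open>r\<close> and \<open>\<rho>\<close> can only be compared intrinsically,
  through lengths of curves. Charts take values in a half-space, and on its edge the normal partial
  derivative is one-sided. The curvature computation is therefore confined to open pieces of the
  charts. The boundary is reached in two ways: the potential by continuity, the induced metric by
  local smooth extensions evaluated along curves. That the boundary read off from charts is the
  bounding sphere of the ball rests on invariance of domain. Flatness is the symmetry of third
  derivatives of the coordinate expression of the isometry: its second derivatives, expanded in the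
  frame of its first derivatives, have the Christoffel symbols as coefficients.\<close>

lemma eventually_line_in_open:
  fixes x v :: "'a::real_normed_vector"
  assumes "open U" "x + t0 *\<^sub>R v \<in> U"
  shows "\<forall>\<^sub>F t in nhds t0. x + t *\<^sub>R v \<in> U"
proof -
  have "((\<lambda>t. x + t *\<^sub>R v) \<longlongrightarrow> x + t0 *\<^sub>R v) (nhds t0)"
    by (intro tendsto_intros filterlim_ident)
  then show ?thesis using assms by (rule topological_tendstoD)
qed

text \<open>\<open>partial_deriv\<close> differentiates along the times that stay in the set. Once
  all nearby times are admissible, the restricted filter is the full one and ordinary calculus
  applies.\<close>

lemma at_within_Collect_eventually:
  fixes a :: "'a::topological_space"
  assumes "\<forall>\<^sub>F t in nhds a. P t"
  shows "at a within {t. P t} = at a"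
  using assms unfolding eventually_nhds
  by (intro at_within_interior) (auto simp: interior_def)

text \<open>Agreement of \<open>h\<close> and \<open>e\<close> is asked for on one coordinate line
  only. This is what makes tangential derivatives at boundary points computable from a local
  extension.\<close>

lemma has_derivative_imp_partial_deriv:
  assumes "(e has_derivative D) (at x)"
    and "\<forall>\<^sub>F t in nhds 0. x + t *\<^sub>R axis i 1 \<in> S"
    and "\<forall>\<^sub>F t in nhds 0. h (x + t *\<^sub>R axis i 1) = e (x + t *\<^sub>R axis i 1)"
  shows "partial_deriv S i h x = D (axis i 1)"
proof -
  have D: "bounded_linear D" using assms(1) by (rule has_derivative_bounded_linear)
  have "((\<lambda>t. x + t *\<^sub>R axis i 1) has_derivative (\<lambda>t. t *\<^sub>R axis i (1::real))) (at (0::real))"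
    by (auto intro!: derivative_eq_intros)
  from has_derivative_compose[OF this, of e D] assms(1)
  have "((\<lambda>t. e (x + t *\<^sub>R axis i 1)) has_vector_derivative D (axis i 1)) (at 0)"
    by (simp add: has_vector_derivative_def linear_cmul[OF bounded_linear.linear[OF D]])
  then have "((\<lambda>t. h (x + t *\<^sub>R axis i 1)) has_vector_derivative D (axis i 1)) (at 0)"
    by (rule has_vector_derivative_cong_ev[THEN iffD2, rotated 2])
      (use assms(3) in \<open>auto dest: eventually_nhds_x_imp_x elim: eventually_mono\<close>)
  then show ?thesis
    unfolding partial_deriv_def at_within_Collect_eventually[OF assms(2)]
    by (rule vector_derivative_at)
qed

lemma partial_deriv_cong_open:
  assumes "open U" "x \<in> U" "U \<subseteq> S" "\<And>y. y \<in> U \<Longrightarrow> h y = h' y"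
  shows "partial_deriv S i h x = partial_deriv U i h' x"
proof -
  have ev: "\<forall>\<^sub>F t in nhds 0. x + t *\<^sub>R axis i 1 \<in> U"
    using assms(1,2) by (intro eventually_line_in_open) auto
  then have evS: "\<forall>\<^sub>F t in nhds 0. x + t *\<^sub>R axis i 1 \<in> S"
    by (rule eventually_mono) (use assms in auto)
  show ?thesis
    unfolding partial_deriv_def at_within_Collect_eventually[OF ev] at_within_Collect_eventually[OF evS]
    by (rule vector_derivative_cong_eq)
      (use ev assms(4) in \<open>auto elim: eventually_mono\<close>)
qed

text \<open>The induction generalises the functions because \<open>partial_deriv V i h\<close> and
  \<open>partial_deriv U i h'\<close> are different functions that agree only on
  \<open>U\<close>.\<close>

lemma C_k_on_subset_cong:
  assumes "open U" "U \<subseteq> V" "\<And>y. y \<in> U \<Longrightarrow> h y = h' y" "C_k_on k V h"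
  shows "C_k_on k U h'"
  using assms(3,4)
proof (induction k arbitrary: h h')
  case 0
  then show ?case
    using continuous_on_subset[OF _ assms(2), of h] continuous_on_cong[of U U h h'] by simp
next
  case (Suc k)
  have "h differentiable_on U"
    using Suc.prems assms(2) by (auto intro: differentiable_on_subset)
  then have "h' differentiable_on U"
    unfolding differentiable_on_def using Suc.prems(1)
    by (meson differentiable_transform_within zero_less_one)
  moreover have "C_k_on k U (partial_deriv U i h')" for i
  proof (rule Suc.IH)
    show "partial_deriv V i h y = partial_deriv U i h' y" if "y \<in> U" for y
      by (intro partial_deriv_cong_open) (use that assms Suc.prems in auto)
    show "C_k_on k V (partial_deriv V i h)" using Suc.prems by simp
  qed
  ultimately show ?case by simp
qed

text \<open>Local extensions live on different open sets. They can be glued because near a point of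
  \<open>V\<close> the partial derivatives relative to \<open>V\<close> and to \<open>U\<close>
  coincide.\<close>

lemma C_k_on_local:
  assumes "open U" "\<And>x. x \<in> U \<Longrightarrow> \<exists>V. open V \<and> x \<in> V \<and> V \<subseteq> U \<and> C_k_on k V h"
  shows "C_k_on k U h"
  using assms(2)
proof (induction k arbitrary: h)
  case 0
  have "continuous (at x) h" if "x \<in> U" for x
    using 0[OF that] by (auto simp: continuous_on_eq_continuous_at)
  then show ?case by (simp add: assms(1) continuous_on_eq_continuous_at)
next
  case (Suc k)
  have "h differentiable (at x)" if "x \<in> U" for x
    using Suc.prems[OF that] by (auto simp: differentiable_on_eq_differentiable_at)
  then have "h differentiable_on U" 
    by (simp add: assms(1) differentiable_on_eq_differentiable_at)
  moreover have "C_k_on k U (partial_deriv U i h)" for i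
  proof (rule Suc.IH)
    fix x assume "x \<in> U"
    then obtain V where V: "open V" "x \<in> V" "V \<subseteq> U" "C_k_on (Suc k) V h"
      using Suc.prems by blast
    have "C_k_on k V (partial_deriv U i h)"
      by (rule C_k_on_subset_cong[of V V "partial_deriv V i h"])
        (use V in \<open>auto intro!: partial_deriv_cong_open[symmetric]\<close>)
    then show "\<exists>V. open V \<and> x \<in> V \<and> V \<subseteq> U \<and> C_k_on k V (partial_deriv U i h)"
      using V by blast
  qed
  ultimately show ?case by simp
qed

lemma smooth_onE:
  assumes "smooth_on S h" "x \<in> S"
  obtains V e where "open V" "x \<in> V" "\<And>k. C_k_on k V e" "\<And>y. y \<in> S \<Longrightarrow> y \<in> V \<Longrightarrow> e y = h y"
proof -
  have "\<exists>V e. open V \<and> x \<in> V \<and> (\<forall>k. C_k_on k V e) \<and> (\<forall>y\<in>S \<inter> V. e y = h y)"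
    using assms(1)[unfolded smooth_on_def] assms(2) by (rule bspec)
  then obtain V e where "open V" "x \<in> V" "\<forall>k. C_k_on k V e" "\<forall>y\<in>S \<inter> V. e y = h y"
    by (elim exE conjE)
  then show thesis using that[of V e] by simp
qed

lemma smooth_on_imp_C_k_on:
  assumes "smooth_on S h" "open U" "U \<subseteq> S"
  shows "C_k_on k U h"
proof (rule C_k_on_local[OF assms(2)])
  fix x assume "x \<in> U"
  then have "x \<in> S" using assms by auto
  obtain V e where V: "open V" "x \<in> V" "\<And>k. C_k_on k V e" "\<And>y. y \<in> S \<Longrightarrow> y \<in> V \<Longrightarrow> e y = h y"
    by (rule smooth_onE[OF assms(1) \<open>x \<in> S\<close>], rule that)
  have "C_k_on k (U \<inter> V) h"
    by (rule C_k_on_subset_cong[of _ V e]) (use V assms in auto)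
  then show "\<exists>V. open V \<and> x \<in> V \<and> V \<subseteq> U \<and> C_k_on k V h"
    using V assms \<open>x \<in> U\<close> by (intro exI[of _ "U \<inter> V"]) auto
qed

lemma smooth_on_imp_continuous_on:
  assumes "smooth_on S h"
  shows "continuous_on S h"
  unfolding continuous_on_eq_continuous_within
proof
  fix x assume "x \<in> S"
  obtain V e where V: "open V" "x \<in> V" "\<And>k. C_k_on k V e" "\<And>y. y \<in> S \<Longrightarrow> y \<in> V \<Longrightarrow> e y = h y"
    by (rule smooth_onE[OF assms \<open>x \<in> S\<close>], rule that)
  have "continuous_on V e" using V(3)[of 0] by simp
  then have "continuous (at x within S) e"
    using V by (simp add: continuous_on_eq_continuous_at continuous_at_imp_continuous_at_within)
  moreover obtain \<delta> where \<delta>: "\<delta> > 0" "\<forall>y. dist y x < \<delta> \<longrightarrow> y \<in> V"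
    using V(1,2) unfolding open_dist by blast
  moreover have "e x' = h x'" if "x' \<in> S" "dist x' x < \<delta>" for x'
    using V(4) \<delta>(2) that by simp
  ultimately show "continuous (at x within S) h"
    using \<open>x \<in> S\<close> continuous_transform_within by metis
qed

section \<open>Total derivatives and the chain rule along curves\<close>

lemma vec_eq_sum_axis: "(v :: real^'n) = (\<Sum>i\<in>UNIV. v $ i *\<^sub>R axis i 1)"
  using basis_expansion[of v] by (simp add: scalar_mult_eq_scaleR)

lemma sum_axis_scaleR:
  fixes c :: "'n::finite \<Rightarrow> 'b::real_vector"
  shows "(\<Sum>k\<in>UNIV. axis i (1::real) $ k *\<^sub>R c k) = c i"
proof -
  have "axis i (1::real) $ k *\<^sub>R c k = (if k = i then c k else 0)" for k
    by (simp add: axis_def)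
  then show ?thesis by simp
qed

lemma linear_axis_expansion:
  fixes D :: "real^'n \<Rightarrow> 'b::real_vector"
  assumes "linear D"
  shows "D v = (\<Sum>i\<in>UNIV. v $ i *\<^sub>R D (axis i 1))"
proof -
  have "D v = D (\<Sum>i\<in>UNIV. v $ i *\<^sub>R axis i 1)" using vec_eq_sum_axis[of v] by (rule arg_cong)
  then show ?thesis using assms by (simp add: linear_sum linear_cmul)
qed

lemma C_k_on_has_derivative:
  assumes "C_k_on (Suc k) U h" "open U" "x \<in> U"
  shows "(h has_derivative (\<lambda>v. \<Sum>i\<in>UNIV. v $ i *\<^sub>R partial_deriv U i h x)) (at x)"
proof -
  obtain D where D: "(h has_derivative D) (at x)"
    using assms by (auto simp: differentiable_on_eq_differentiable_at differentiable_def)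
  have pd: "partial_deriv U i h x = D (axis i 1)" for i
    by (rule has_derivative_imp_partial_deriv[OF D])
      (use assms in \<open>auto intro!: eventually_line_in_open\<close>)
  have "D = (\<lambda>v. \<Sum>i\<in>UNIV. v $ i *\<^sub>R partial_deriv U i h x)"
    unfolding pd by (rule ext) (use D in \<open>intro linear_axis_expansion has_derivative_linear\<close>)
  from D[unfolded this] show ?thesis .
qed

lemma C_k_on_curve:
  assumes "C_k_on (Suc k) U h" "open U" "y t \<in> U" "(y has_vector_derivative y') (at t)"
  shows "((\<lambda>t. h (y t)) has_vector_derivative (\<Sum>i\<in>UNIV. y' $ i *\<^sub>R partial_deriv U i h (y t))) (at t)"
proof -
  have "((\<lambda>t. h (y t)) has_derivative
      (\<lambda>s. \<Sum>i\<in>UNIV. (s *\<^sub>R y') $ i *\<^sub>R partial_deriv U i h (y t))) (at t)"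
    using has_derivative_compose[OF assms(4)[unfolded has_vector_derivative_def]
        C_k_on_has_derivative[OF assms(1-3)]] .
  then show ?thesis by (simp add: has_vector_derivative_def scaleR_sum_right)
qed

lemma C_k_on_line:
  assumes "C_k_on (Suc k) U h" "open U" "y + t *\<^sub>R axis i 1 \<in> U"
  shows "((\<lambda>t. h (y + t *\<^sub>R axis i 1)) has_vector_derivative
      partial_deriv U i h (y + t *\<^sub>R axis i 1)) (at t)"
proof -
  have "((\<lambda>t. y + t *\<^sub>R axis i 1) has_vector_derivative axis i (1::real)) (at t)"
    by (rule has_vector_derivative_eq_rhs, (rule derivative_intros)+) simp
  from C_k_on_curve[OF assms(1,2), of "\<lambda>t. y + t *\<^sub>R axis i 1" t, OF assms(3) this] show ?thesis
    by (simp add: sum_axis_scaleR)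
qed

lemma partial_deriv_eqI:
  assumes "((\<lambda>t. h (x + t *\<^sub>R axis i 1)) has_vector_derivative d) (at 0)" "open U" "x \<in> U"
  shows "partial_deriv U i h x = d"
proof -
  have ev: "\<forall>\<^sub>F t in nhds 0. x + t *\<^sub>R axis i 1 \<in> U"
    using assms by (intro eventually_line_in_open) auto
  show ?thesis
    unfolding partial_deriv_def at_within_Collect_eventually[OF ev]
    using assms(1) by (rule vector_derivative_at)
qed

lemma C_k_on_partial_at_0:
  assumes "C_k_on (Suc k) U h" "open U" "x \<in> U"
  shows "((\<lambda>t. h (x + t *\<^sub>R axis i 1)) has_vector_derivative partial_deriv U i h x) (at 0)"
  using C_k_on_line[OF assms(1,2), of x 0 i] assms(3) by simp

lemma partial_deriv_inner:
  fixes h :: "real^'n::finite \<Rightarrow> 'b::real_inner"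
  assumes "C_k_on (Suc k) U h" "open U" "x \<in> U"
  shows "partial_deriv U i (\<lambda>y. h y \<bullet> a) x = partial_deriv U i h x \<bullet> a"
  by (rule partial_deriv_eqI[OF bounded_linear.has_vector_derivative[OF bounded_linear_inner_left]])
    (use assms C_k_on_partial_at_0[OF assms] in auto)

lemma C_k_on_inner:
  fixes h :: "real^'n::finite \<Rightarrow> 'b::real_inner"
  assumes "C_k_on k U h" "open U"
  shows "C_k_on k U (\<lambda>y. h y \<bullet> a)"
  using assms(1)
proof (induction k arbitrary: h)
  case 0
  then show ?case by (auto intro!: continuous_intros)
next
  case (Suc k)
  have "C_k_on k U (partial_deriv U i (\<lambda>y. h y \<bullet> a))" for i
    by (rule C_k_on_subset_cong[of U U "\<lambda>y. partial_deriv U i h y \<bullet> a"])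
      (use Suc assms(2) in \<open>auto simp: partial_deriv_inner[OF Suc.prems assms(2)]\<close>)
  moreover have "(\<lambda>y. h y \<bullet> a) differentiable_on U"
    unfolding differentiable_on_def differentiable_def
    using C_k_on_has_derivative[OF Suc.prems assms(2)]
    by (blast intro: has_derivative_inner_left has_derivative_at_withinI)
  ultimately show ?case by simp
qed

text \<open>The core of Schwarz's theorem: the mean value theorem, once in each direction, applied
  to the second difference over a small square. That difference is symmetric in \<open>i\<close> and
  \<open>j\<close>, while the right-hand side is not visibly so. The bound on \<open>2 * s\<close>
  keeps the square inside the ball, also when \<open>i = j\<close>.\<close>

lemma second_difference_mean_value:
  fixes h :: "real^'n::finite \<Rightarrow> real"
  assumes h: "C_k_on 2 U h" and U: "open U" and B: "ball x \<delta> \<subseteq> U" and s: "0 < s" "2 * s < \<delta>"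
  shows "\<exists>\<xi>\<in>ball x \<delta>. h (x + s *\<^sub>R axis i 1 + s *\<^sub>R axis j 1) - h (x + s *\<^sub>R axis i 1)
           - h (x + s *\<^sub>R axis j 1) + h x = s * s * partial_deriv U j (partial_deriv U i h) \<xi>"
proof -
  let ?P = "partial_deriv U"
  have in_ball: "x + a *\<^sub>R axis i 1 + b *\<^sub>R axis j 1 \<in> ball x \<delta>" if "0 \<le> a" "a \<le> s" "0 \<le> b" "b \<le> s" for a b
  proof -
    have "norm (a *\<^sub>R axis i 1 + b *\<^sub>R axis j (1::real)) \<le> norm (a *\<^sub>R axis i (1::real)) + norm (b *\<^sub>R axis j (1::real))"
      by (rule norm_triangle_ineq)
    also have "\<dots> < \<delta>" using that s by (simp add: norm_axis_1)
    finally have "dist (x + (a *\<^sub>R axis i 1 + b *\<^sub>R axis j 1)) x < \<delta>" by (simp add: dist_norm)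
    then show ?thesis by (simp add: dist_commute add.assoc)
  qed
  have h1: "C_k_on (Suc 1) U h" using h by (simp add: numeral_2_eq_2)
  have h2: "C_k_on (Suc 0) U (?P i h)" using h by (simp add: numeral_2_eq_2)
  \<comment> \<open>The increment across the square in direction \<open>j\<close>, as a function of
    the position in direction \<open>i\<close>.\<close>
  define u where "u = (\<lambda>t. h (x + s *\<^sub>R axis j 1 + t *\<^sub>R axis i 1) - h (x + t *\<^sub>R axis i 1))"
  have "\<exists>t. 0 < t \<and> t < s \<and> u s - u 0 = (s - 0) * (?P i h (x + s *\<^sub>R axis j 1 + t *\<^sub>R axis i 1) - ?P i h (x + t *\<^sub>R axis i 1))"
  proof (rule MVT2)
    fix t assume t: "0 \<le> t" "t \<le> s"
    have "(u has_vector_derivative ?P i h (x + s *\<^sub>R axis j 1 + t *\<^sub>R axis i 1) - ?P i h (x + t *\<^sub>R axis i 1)) (at t)"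
      unfolding u_def
      using in_ball[of t s] in_ball[of t 0] t s B
      by (intro derivative_intros C_k_on_line[OF h1 U]) (auto simp: algebra_simps)
    then show "(u has_real_derivative ?P i h (x + s *\<^sub>R axis j 1 + t *\<^sub>R axis i 1) - ?P i h (x + t *\<^sub>R axis i 1)) (at t)"
      by (simp add: has_real_derivative_iff_has_vector_derivative)
  qed (use s in auto)
  then obtain t1 where t1: "0 < t1" "t1 < s"
    and u: "u s - u 0 = s * (?P i h (x + s *\<^sub>R axis j 1 + t1 *\<^sub>R axis i 1) - ?P i h (x + t1 *\<^sub>R axis i 1))"
    by auto
  define w where "w = (\<lambda>t. ?P i h (x + t1 *\<^sub>R axis i 1 + t *\<^sub>R axis j 1))"
  have "\<exists>t. 0 < t \<and> t < s \<and> w s - w 0 = (s - 0) * ?P j (?P i h) (x + t1 *\<^sub>R axis i 1 + t *\<^sub>R axis j 1)"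
  proof (rule MVT2)
    fix t assume t: "0 \<le> t" "t \<le> s"
    show "(w has_real_derivative ?P j (?P i h) (x + t1 *\<^sub>R axis i 1 + t *\<^sub>R axis j 1)) (at t)"
      unfolding w_def has_real_derivative_iff_has_vector_derivative
      using in_ball[of t1 t] t t1 B by (intro C_k_on_line[OF h2 U]) auto
  qed (use s in auto)
  then obtain t2 where t2: "0 < t2" "t2 < s"
    and w: "w s - w 0 = s * ?P j (?P i h) (x + t1 *\<^sub>R axis i 1 + t2 *\<^sub>R axis j 1)" by auto
  have "u s - u 0 = s * s * ?P j (?P i h) (x + t1 *\<^sub>R axis i 1 + t2 *\<^sub>R axis j 1)"
    using u w by (simp add: w_def algebra_simps)
  moreover have "u s - u 0 = h (x + s *\<^sub>R axis i 1 + s *\<^sub>R axis j 1) - h (x + s *\<^sub>R axis i 1)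
           - h (x + s *\<^sub>R axis j 1) + h x"
    by (simp add: u_def algebra_simps)
  ultimately show ?thesis using in_ball[of t1 t2] t1 t2 by force
qed

lemma partial_deriv_commute_real:
  fixes h :: "real^'n::finite \<Rightarrow> real"
  assumes h: "C_k_on 2 U h" and U: "open U" and x: "x \<in> U"
  shows "partial_deriv U i (partial_deriv U j h) x = partial_deriv U j (partial_deriv U i h) x"
proof (rule ccontr)
  let ?A = "partial_deriv U i (partial_deriv U j h)" and ?B = "partial_deriv U j (partial_deriv U i h)"
  assume ne: "?A x \<noteq> ?B x"
  \<comment> \<open>Half the supposed gap: two errors below it cannot bridge the gap.\<close>
  define \<epsilon> where "\<epsilon> = \<bar>?A x - ?B x\<bar> / 2"
  have "\<epsilon> > 0" using ne by (simp add: \<epsilon>_def)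
  have "continuous_on U ?A" "continuous_on U ?B" using h by (simp_all add: numeral_2_eq_2)
  then have "isCont ?A x" "isCont ?B x" using U x by (simp_all add: continuous_on_eq_continuous_at)
  then obtain d1 d2 where d: "d1 > 0" "d2 > 0"
    "\<And>y. dist y x < d1 \<Longrightarrow> dist (?A y) (?A x) < \<epsilon>" "\<And>y. dist y x < d2 \<Longrightarrow> dist (?B y) (?B x) < \<epsilon>"
    unfolding continuous_at_eps_delta using \<open>\<epsilon> > 0\<close> by metis
  obtain d3 where d3: "d3 > 0" "ball x d3 \<subseteq> U" using U x open_contains_ball by blast
  define \<delta> where "\<delta> = min d1 (min d2 d3)"
  have \<delta>: "\<delta> > 0" "ball x \<delta> \<subseteq> U" using d d3 by (auto simp: \<delta>_def)
  obtain s where s: "0 < s" "2 * s < \<delta>" using \<delta> by (intro that[of "\<delta>/3"]) auto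
  obtain \<xi> where \<xi>: "\<xi> \<in> ball x \<delta>" "h (x + s *\<^sub>R axis i 1 + s *\<^sub>R axis j 1) - h (x + s *\<^sub>R axis i 1)
           - h (x + s *\<^sub>R axis j 1) + h x = s * s * ?B \<xi>"
    using second_difference_mean_value[OF h U \<delta>(2) s] by blast
  obtain \<eta> where \<eta>: "\<eta> \<in> ball x \<delta>" "h (x + s *\<^sub>R axis j 1 + s *\<^sub>R axis i 1) - h (x + s *\<^sub>R axis j 1)
           - h (x + s *\<^sub>R axis i 1) + h x = s * s * ?A \<eta>"
    using second_difference_mean_value[OF h U \<delta>(2) s] by blast
  have "h (x + s *\<^sub>R axis j 1 + s *\<^sub>R axis i 1) = h (x + s *\<^sub>R axis i 1 + s *\<^sub>R axis j 1)"
    by (simp add: add.assoc add.commute[of "s *\<^sub>R axis j 1"])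
  then have "s * s * ?A \<eta> = s * s * ?B \<xi>" using \<xi>(2) \<eta>(2) by linarith
  then have eq: "?A \<eta> = ?B \<xi>" using s by simp
  have "dist (?A \<eta>) (?A x) < \<epsilon>" "dist (?B \<xi>) (?B x) < \<epsilon>"
    using d(3)[of \<eta>] d(4)[of \<xi>] \<xi>(1) \<eta>(1) by (auto simp: \<delta>_def dist_commute)
  moreover have "dist (?A x) (?B x) \<le> dist (?A \<eta>) (?A x) + dist (?A \<eta>) (?B x)" by (rule dist_triangle3)
  moreover have "dist (?A x) (?B x) = 2 * \<epsilon>" by (simp add: \<epsilon>_def dist_real_def)
  ultimately show False using eq by simp
qed

text \<open>Pairing with a fixed vector commutes with partial derivatives, so testing against every
  \<open>a\<close> reduces the claim to real functions.\<close>

lemma partial_deriv_commute: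
  fixes h :: "real^'n::finite \<Rightarrow> 'b::real_inner"
  assumes h: "C_k_on 2 U h" and U: "open U" and x: "x \<in> U"
  shows "partial_deriv U i (partial_deriv U j h) x = partial_deriv U j (partial_deriv U i h) x"
proof -
  have twice: "partial_deriv U i (partial_deriv U j (\<lambda>y. h y \<bullet> a)) x = partial_deriv U i (partial_deriv U j h) x \<bullet> a" for i j a
  proof -
    have h1: "C_k_on (Suc 1) U h" "C_k_on (Suc 0) U (partial_deriv U j h)"
      using h by (simp_all add: numeral_2_eq_2)
    have "partial_deriv U i (partial_deriv U j (\<lambda>y. h y \<bullet> a)) x = partial_deriv U i (\<lambda>y. partial_deriv U j h y \<bullet> a) x"
      by (rule partial_deriv_cong_open[OF U x]) (auto simp: partial_deriv_inner[OF h1(1) U])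
    then show ?thesis using partial_deriv_inner[OF h1(2) U x] by simp
  qed
  have "(partial_deriv U i (partial_deriv U j h) x - partial_deriv U j (partial_deriv U i h) x) \<bullet> a = 0" for a
    using partial_deriv_commute_real[OF C_k_on_inner[OF h U] U x, of i j a]
    by (simp add: twice inner_diff_left)
  then show ?thesis by (metis inner_eq_zero_iff right_minus_eq)
qed

section \<open>Flat coordinates\<close>

text \<open>A variant of \<open>C_k_on_partial_at_0\<close> for functions known only to be
  differentiable at the point; it serves the Christoffel symbols.\<close>

lemma differentiable_on_line:
  assumes "h differentiable (at x)" "open U" "x \<in> U"
  shows "((\<lambda>t. h (x + t *\<^sub>R axis i 1)) has_vector_derivative partial_deriv U i h x) (at 0)"
proof -
  obtain D where D: "(h has_derivative D) (at x)" using assms by (auto simp: differentiable_def)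
  have pd: "partial_deriv U i h x = D (axis i 1)"
    by (rule has_derivative_imp_partial_deriv[OF D])
      (use assms in \<open>auto intro!: eventually_line_in_open\<close>)
  have "((\<lambda>t. x + t *\<^sub>R axis i 1) has_derivative (\<lambda>t. t *\<^sub>R axis i (1::real))) (at (0::real))"
    by (auto intro!: derivative_eq_intros)
  from has_derivative_compose[OF this, of h D] D
  show ?thesis unfolding pd
    by (simp add: has_vector_derivative_def linear_cmul[OF has_derivative_linear[OF D]])
qed

lemma has_vector_derivative_transform_eventually:
  assumes "(f has_vector_derivative d) (at t)" "\<forall>\<^sub>F s in nhds t. f s = g s"
  shows "(g has_vector_derivative d) (at t)"
  by (rule has_vector_derivative_cong_ev[THEN iffD1, OF _ _ assms(1)])
    (use assms(2) in \<open>auto dest: eventually_nhds_x_imp_x elim: eventually_mono\<close>)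

text \<open>The product rule for the first derivative along the curve: the single sum comes from the
  acceleration of the curve, the double sum is the coordinate second derivative of \<open>h\<close>
  on the velocity.\<close>

lemma C_2_on_curve_second:
  assumes h: "C_k_on 2 U h" and U: "open U" and y: "y t \<in> U"
    and y1: "(y has_vector_derivative y1 t) (at t)" and y2: "(y1 has_vector_derivative y2) (at t)"
  shows "((\<lambda>t. \<Sum>i\<in>UNIV. y1 t $ i *\<^sub>R partial_deriv U i h (y t)) has_vector_derivative
      (\<Sum>i\<in>UNIV. y2 $ i *\<^sub>R partial_deriv U i h (y t)) +
      (\<Sum>i\<in>UNIV. \<Sum>j\<in>UNIV. (y1 t $ i * y1 t $ j) *\<^sub>R partial_deriv U j (partial_deriv U i h) (y t))) (at t)"
proof -
  have h1: "C_k_on (Suc 0) U (partial_deriv U i h)" for i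
    using h by (simp add: numeral_2_eq_2)
  have c: "((\<lambda>t. y1 t $ i) has_vector_derivative y2 $ i) (at t)" for i
    using y2 by (rule bounded_linear.has_vector_derivative[OF bounded_linear_vec_nth])
  have "((\<lambda>t. \<Sum>i\<in>UNIV. y1 t $ i *\<^sub>R partial_deriv U i h (y t)) has_vector_derivative
      (\<Sum>i\<in>UNIV. y1 t $ i *\<^sub>R (\<Sum>j\<in>UNIV. y1 t $ j *\<^sub>R partial_deriv U j (partial_deriv U i h) (y t))
        + y2 $ i *\<^sub>R partial_deriv U i h (y t))) (at t)"
    by (intro has_vector_derivative_sum has_vector_derivative_scaleR C_k_on_curve[where y = y, OF h1 U y y1])
      (use c in \<open>simp add: has_real_derivative_iff_has_vector_derivative\<close>)
  then show ?thesis by (simp add: sum.distrib scaleR_sum_right add.commute)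
qed

text \<open>A chart of a flat metric: \<open>G\<close> is the pullback of the Euclidean metric.
  Carrying the smooth inverse \<open>\<Psi>\<close> makes the Jacobian invertible by the chain rule
  and later gives differentiability of the Christoffel symbols.\<close>

locale flat_coordinates =
  fixes U W :: "(real^'n::finite) set" and \<Phi> \<Psi> :: "real^'n \<Rightarrow> real^'n"
    and G :: "real^'n \<Rightarrow> real^'n^'n"
  assumes open_U: "open U" and open_W: "open W"
    and smooth_\<Phi>: "\<And>k. C_k_on k U \<Phi>" and smooth_\<Psi>: "\<And>k. C_k_on k W \<Psi>"
    and \<Phi>_in: "\<And>x. x \<in> U \<Longrightarrow> \<Phi> x \<in> W" and \<Psi>_in: "\<And>z. z \<in> W \<Longrightarrow> \<Psi> z \<in> U"
    and \<Psi>_\<Phi>: "\<And>x. x \<in> U \<Longrightarrow> \<Psi> (\<Phi> x) = x" and \<Phi>_\<Psi>: "\<And>z. z \<in> W \<Longrightarrow> \<Phi> (\<Psi> z) = z"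
    and G_eq: "\<And>x i j. x \<in> U \<Longrightarrow> G x $ i $ j = partial_deriv U i \<Phi> x \<bullet> partial_deriv U j \<Phi> x"
begin

abbreviation E where "E i \<equiv> partial_deriv U i \<Phi>"

abbreviation E2 where "E2 i j \<equiv> partial_deriv U i (partial_deriv U j \<Phi>)"

abbreviation \<Gamma> where "\<Gamma> \<equiv> christoffel U G"

text \<open>The differential of \<open>\<Phi>\<close> at \<open>x\<close>.\<close>

definition J where "J x c = (\<Sum>i\<in>UNIV. c $ i *\<^sub>R E i x)"

text \<open>The differential of \<open>\<Psi>\<close> at \<open>\<Phi> x\<close>, hence the inverse
  of \<open>J x\<close>.\<close>

definition Q where "Q x v = (\<Sum>m\<in>UNIV. v $ m *\<^sub>R partial_deriv W m \<Psi> (\<Phi> x))"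

section \<open>The Jacobian, the connection and the curvature of a pulled-back Euclidean
  metric\<close>

lemma smooth_E: "C_k_on k U (E i)" and smooth_E2: "C_k_on k U (E2 i j)"
  using smooth_\<Phi>[of "Suc (Suc k)"] smooth_\<Phi>[of "Suc k"] by auto

lemma linear_J: "linear (J x)"
  unfolding J_def
  by (intro linearI) (auto simp: scaleR_add_left sum.distrib scaleR_sum_right)

lemma linear_Q: "linear (Q x)"
  unfolding Q_def
  by (intro linearI) (auto simp: scaleR_add_left sum.distrib scaleR_sum_right)

lemma Q_E: assumes x: "x \<in> U" shows "Q x (E i x) = axis i 1"
proof -
  have \<Phi>': "((\<lambda>t. \<Phi> (x + t *\<^sub>R axis i 1)) has_vector_derivative E i x) (at 0)"
    using smooth_\<Phi> open_U x by (rule C_k_on_partial_at_0)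
  have "((\<lambda>t. \<Psi> (\<Phi> (x + t *\<^sub>R axis i 1))) has_vector_derivative Q x (E i x)) (at 0)"
    using C_k_on_curve[OF smooth_\<Psi> open_W, of "\<lambda>t. \<Phi> (x + t *\<^sub>R axis i 1)" 0, OF _ \<Phi>'] \<Phi>_in[OF x]
    by (simp add: Q_def)
  moreover have "\<forall>\<^sub>F t in nhds 0. x + t *\<^sub>R axis i 1 \<in> U"
    using open_U x by (intro eventually_line_in_open) auto
  then have "\<forall>\<^sub>F t in nhds 0. \<Psi> (\<Phi> (x + t *\<^sub>R axis i 1)) = x + t *\<^sub>R axis i 1"
    by (rule eventually_mono) (rule \<Psi>_\<Phi>)
  ultimately have "((\<lambda>t. x + t *\<^sub>R axis i 1) has_vector_derivative Q x (E i x)) (at 0)"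
    by (rule has_vector_derivative_transform_eventually)
  moreover have "((\<lambda>t. x + t *\<^sub>R axis i 1) has_vector_derivative axis i (1::real)) (at 0)"
    by (rule has_vector_derivative_eq_rhs, (rule derivative_intros)+) simp
  ultimately show ?thesis by (rule vector_derivative_unique_at)
qed

lemma Q_J: assumes x: "x \<in> U" shows "Q x (J x c) = c"
proof -
  have "Q x (J x c) = (\<Sum>i\<in>UNIV. c $ i *\<^sub>R Q x (E i x))"
    unfolding J_def by (simp add: linear_sum[OF linear_Q] linear_cmul[OF linear_Q])
  also have "\<dots> = c" using vec_eq_sum_axis[of c] by (simp add: Q_E[OF x])
  finally show ?thesis .
qed

text \<open>In finite dimension a left inverse of an endomorphism is two-sided, so no second use of
  the chain rule is needed.\<close>

lemma J_Q: assumes x: "x \<in> U" shows "J x (Q x v) = v"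
proof -
  have "inj (J x)" using Q_J[OF x] by (metis injI)
  then have "surj (J x)" using linear_injective_imp_surjective[OF linear_J] by blast
  then obtain c where "v = J x c" by (metis surjD)
  then show ?thesis by (simp add: Q_J[OF x])
qed

lemma G_mult_vec: assumes x: "x \<in> U" shows "(G x *v c) $ l = E l x \<bullet> J x c"
  by (simp add: matrix_vector_mult_def G_eq[OF x] J_def inner_sum_right mult.commute)

text \<open>\<open>G x\<close> is the Gram matrix of the frame \<open>E\<close>: a vector
  \<open>c\<close> in its kernel satisfies \<open>J x c \<bullet> J x c = 0\<close>, hence
  vanishes.\<close>

lemma matrix_inv_G: assumes x: "x \<in> U" shows "matrix_inv (G x) ** G x = mat 1"
proof -
  have "c = 0" if "G x *v c = 0" for c
  proof -
    have "J x c \<bullet> J x c = (\<Sum>l\<in>UNIV. c $ l * (E l x \<bullet> J x c))"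
      by (subst (1) J_def) (simp add: inner_sum_left)
    also have "\<dots> = 0" using that by (simp flip: G_mult_vec[OF x])
    finally have "J x c = 0" by simp
    then show ?thesis using Q_J[OF x, of c] linear_0[OF linear_Q] by simp
  qed
  then have "invertible (G x)"
    by (simp add: invertible_left_inverse matrix_left_invertible_ker)
  then show ?thesis unfolding invertible_def matrix_inv_def by (rule someI2_ex) simp
qed

lemma partial_G: assumes x: "x \<in> U"
  shows "partial_deriv U l (\<lambda>y. G y $ i $ j) x = E2 l i x \<bullet> E j x + E i x \<bullet> E2 l j x"
proof -
  have "partial_deriv U l (\<lambda>y. G y $ i $ j) x = partial_deriv U l (\<lambda>y. E i y \<bullet> E j y) x"
    using open_U x G_eq by (intro partial_deriv_cong_open) auto
  also have "\<dots> = E2 l i x \<bullet> E j x + E i x \<bullet> E2 l j x"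
  proof (rule partial_deriv_eqI[OF _ open_U x])
    have d: "((\<lambda>t. E i (x + t *\<^sub>R axis l 1)) has_vector_derivative E2 l i x) (at 0)" for i
      using smooth_E open_U x by (rule C_k_on_partial_at_0)
    from bounded_bilinear.has_vector_derivative[OF bounded_bilinear_inner d[of i] d[of j]]
    show "((\<lambda>t. E i (x + t *\<^sub>R axis l 1) \<bullet> E j (x + t *\<^sub>R axis l 1)) has_vector_derivative
        E2 l i x \<bullet> E j x + E i x \<bullet> E2 l j x) (at 0)"
      by (simp add: add.commute)
  qed
  finally show ?thesis .
qed

lemma E2_commute: "x \<in> U \<Longrightarrow> E2 i j x = E2 j i x"
  using partial_deriv_commute[OF smooth_\<Phi> open_U] .

text \<open>By the product rule and the symmetry of \<open>E2\<close>, all terms in the three metric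
  derivatives cancel except \<open>2 * (E2 i j x \<bullet> E l x)\<close>. So the Christoffel
  symbols are the coordinates of \<open>E2 i j x\<close> in the frame \<open>E\<close>.\<close>

lemma christoffel_eq: assumes x: "x \<in> U" shows "\<Gamma> k i j x = Q x (E2 i j x) $ k"
proof -
  define c where "c = Q x (E2 i j x)"
  have "partial_deriv U i (\<lambda>y. G y $ j $ l) x + partial_deriv U j (\<lambda>y. G y $ i $ l) x
      - partial_deriv U l (\<lambda>y. G y $ i $ j) x = 2 * (G x *v c) $ l" for l
    unfolding partial_G[OF x] G_mult_vec[OF x] c_def J_Q[OF x]
    using E2_commute[OF x, of j i] E2_commute[OF x, of l i] E2_commute[OF x, of l j]
    by (simp add: inner_commute)
  then have "\<Gamma> k i j x = (\<Sum>l\<in>UNIV. matrix_inv (G x) $ k $ l * (2 * (G x *v c) $ l)) / 2"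
    unfolding christoffel_def by simp
  also have "\<dots> = (matrix_inv (G x) *v (G x *v c)) $ k"
    by (simp add: matrix_vector_mult_def[of "matrix_inv (G x)"] sum_divide_distrib)
  also have "\<dots> = c $ k" by (simp add: matrix_vector_mul_assoc matrix_inv_G[OF x])
  finally show ?thesis unfolding c_def .
qed

lemma sum_christoffel_E: assumes x: "x \<in> U" shows "(\<Sum>k\<in>UNIV. \<Gamma> k i j x *\<^sub>R E k x) = E2 i j x"
  using J_Q[OF x, of "E2 i j x"] by (simp add: J_def christoffel_eq[OF x])

text \<open>The form given by \<open>christoffel_eq\<close> involves only derivatives of
  \<open>\<Phi>\<close> and \<open>\<Psi>\<close>, so \<open>matrix_inv\<close> need not be
  differentiated.\<close>

lemma christoffel_differentiable: assumes x: "x \<in> U" shows "\<Gamma> k i j differentiable (at x)"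
proof -
  have d1: "E2 i j differentiable (at x)"
    using C_k_on_has_derivative[OF smooth_E2 open_U x] by (auto simp: differentiable_def)
  have d2: "\<Phi> differentiable (at x)"
    using C_k_on_has_derivative[OF smooth_\<Phi> open_U x] by (auto simp: differentiable_def)
  have s: "C_k_on (Suc 0) W (partial_deriv W m \<Psi>)" for m using smooth_\<Psi>[of "Suc (Suc 0)"] by simp
  have d3: "partial_deriv W m \<Psi> differentiable (at (\<Phi> x))" for m
    using C_k_on_has_derivative[OF s open_W \<Phi>_in[OF x]] unfolding differentiable_def by blast
  have d4: "(\<lambda>y. partial_deriv W m \<Psi> (\<Phi> y)) differentiable (at x)" for m
    using differentiable_chain_at[OF d2 d3] by (simp add: o_def)
  have nth: "(\<lambda>y. h y $ k) differentiable (at x)" if "h differentiable (at x)" for h :: "real^'n \<Rightarrow> real^'n" and k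
    using that bounded_linear.has_derivative[OF bounded_linear_vec_nth] unfolding differentiable_def by blast
  have "(\<lambda>y. Q y (E2 i j y) $ k) differentiable (at x)"
    unfolding Q_def sum_component vector_scaleR_component
    by (intro differentiable_sum finite_class.finite_UNIV ballI differentiable_scaleR nth d1 d4)
  then obtain D where "((\<lambda>y. Q y (E2 i j y) $ k) has_derivative D) (at x)"
    by (auto simp: differentiable_def)
  then have "(\<Gamma> k i j has_derivative D) (at x)"
    by (rule has_derivative_transform_within_open[OF _ open_U x]) (simp add: christoffel_eq)
  then show ?thesis by (auto simp: differentiable_def)
qed

text \<open>Differentiate \<open>sum_christoffel_E\<close> and expand the new second derivatives by
  the same identity. The coefficients are one half of the formula for \<open>riemann\<close>, the
  other half arising by exchanging \<open>i\<close> and \<open>j\<close>.\<close>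

lemma third_derivative: assumes x: "x \<in> U"
  shows "partial_deriv U i (E2 j k) x =
    (\<Sum>l\<in>UNIV. (partial_deriv U i (\<Gamma> l j k) x + (\<Sum>m\<in>UNIV. \<Gamma> l i m x * \<Gamma> m j k x)) *\<^sub>R E l x)"
proof -
  have "partial_deriv U i (E2 j k) x = partial_deriv U i (\<lambda>y. \<Sum>l\<in>UNIV. \<Gamma> l j k y *\<^sub>R E l y) x"
    using open_U x by (intro partial_deriv_cong_open) (auto simp: sum_christoffel_E)
  also have "\<dots> = (\<Sum>l\<in>UNIV. \<Gamma> l j k x *\<^sub>R E2 i l x + partial_deriv U i (\<Gamma> l j k) x *\<^sub>R E l x)"
  proof (rule partial_deriv_eqI[OF _ open_U x])
    have d: "((\<lambda>t. E l (x + t *\<^sub>R axis i 1)) has_vector_derivative E2 i l x) (at 0)" for l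
      using smooth_E open_U x by (rule C_k_on_partial_at_0)
    have g: "((\<lambda>t. \<Gamma> l j k (x + t *\<^sub>R axis i 1)) has_vector_derivative partial_deriv U i (\<Gamma> l j k) x) (at 0)" for l
      using christoffel_differentiable[OF x] open_U x by (rule differentiable_on_line)
    have "((\<lambda>t. \<Gamma> l j k (x + t *\<^sub>R axis i 1) *\<^sub>R E l (x + t *\<^sub>R axis i 1)) has_vector_derivative
        \<Gamma> l j k x *\<^sub>R E2 i l x + partial_deriv U i (\<Gamma> l j k) x *\<^sub>R E l x) (at 0)" for l
      using bounded_bilinear.has_vector_derivative[OF bounded_bilinear_scaleR g[of l] d[of l]] by simp
    then show "((\<lambda>t. \<Sum>l\<in>UNIV. \<Gamma> l j k (x + t *\<^sub>R axis i 1) *\<^sub>R E l (x + t *\<^sub>R axis i 1)) has_vector_derivative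
        (\<Sum>l\<in>UNIV. \<Gamma> l j k x *\<^sub>R E2 i l x + partial_deriv U i (\<Gamma> l j k) x *\<^sub>R E l x)) (at 0)"
      by (rule has_vector_derivative_sum)
  qed
  also have "\<dots> = (\<Sum>m\<in>UNIV. \<Gamma> m j k x *\<^sub>R (\<Sum>l\<in>UNIV. \<Gamma> l i m x *\<^sub>R E l x))
      + (\<Sum>l\<in>UNIV. partial_deriv U i (\<Gamma> l j k) x *\<^sub>R E l x)"
    by (simp add: sum.distrib sum_christoffel_E[OF x])
  also have "(\<Sum>m\<in>UNIV. \<Gamma> m j k x *\<^sub>R (\<Sum>l\<in>UNIV. \<Gamma> l i m x *\<^sub>R E l x))
      = (\<Sum>l\<in>UNIV. \<Sum>m\<in>UNIV. (\<Gamma> l i m x * \<Gamma> m j k x) *\<^sub>R E l x)"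
    unfolding scaleR_sum_right by (subst sum.swap) (simp add: mult.commute)
  finally show ?thesis by (simp add: scaleR_add_left sum.distrib scaleR_sum_left add.commute)
qed

text \<open>Antisymmetrising \<open>third_derivative\<close> in \<open>i\<close> and
  \<open>j\<close> gives zero because second derivatives of \<open>E k\<close> commute; injectivity
  of \<open>J x\<close> then kills each coefficient.\<close>

lemma riemann_eq_0: assumes x: "x \<in> U" shows "riemann U G l k i j x = 0"
proof -
  have "C_k_on 2 U (E k)" by (rule smooth_E)
  from partial_deriv_commute[OF this open_U x]
  have "partial_deriv U i (E2 j k) x - partial_deriv U j (E2 i k) x = 0" by simp
  then have "J x (\<chi> l. riemann U G l k i j x) = 0"
    unfolding third_derivative[OF x] sum_subtractf[symmetric] scaleR_diff_left[symmetric]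
    by (simp add: J_def riemann_def sum_subtractf algebra_simps)
  then have "(\<chi> l. riemann U G l k i j x) = 0"
    using Q_J[OF x] linear_0[OF linear_Q] by metis
  then show ?thesis by (simp add: vec_eq_iff)
qed

lemma ricci_eq_0: "x \<in> U \<Longrightarrow> ricci U G i j x = 0"
  by (simp add: ricci_def riemann_eq_0)

text \<open>Straight lines in \<open>W\<close> are the geodesics of the flat metric, and along a
  unit-speed geodesic the second derivative of a function is its Hessian on the velocity. The first
  derivative is supplied on a neighbourhood of \<open>t0\<close>, so that it makes sense to
  differentiate it again.\<close>

lemma second_derivative_along_line:
  fixes h :: "real^'n \<Rightarrow> real"
  assumes h: "\<And>k. C_k_on k U h"
    and hess: "\<And>x i j. x \<in> U \<Longrightarrow> hessian U G h i j x = \<mu> * G x $ i $ j"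
    and z: "z + t0 *\<^sub>R axis m 1 \<in> W"
  shows "\<exists>\<phi>'. (\<forall>\<^sub>F t in nhds t0. ((\<lambda>t. h (\<Psi> (z + t *\<^sub>R axis m 1))) has_real_derivative \<phi>' t) (at t))
           \<and> (\<phi>' has_real_derivative \<mu>) (at t0)"
proof -
  define y where "y t = \<Psi> (z + t *\<^sub>R axis m 1)" for t
  define y1 where "y1 t = partial_deriv W m \<Psi> (z + t *\<^sub>R axis m 1)" for t
  define y2 where "y2 = partial_deriv W m (partial_deriv W m \<Psi>) (z + t0 *\<^sub>R axis m 1)"
  have evW: "\<forall>\<^sub>F t in nhds t0. z + t *\<^sub>R axis m 1 \<in> W"
    using open_W z by (rule eventually_line_in_open)
  have y1: "(y has_vector_derivative y1 t) (at t)" if "z + t *\<^sub>R axis m 1 \<in> W" for t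
    unfolding y_def y1_def using smooth_\<Psi> open_W that by (rule C_k_on_line)
  have "C_k_on (Suc 0) W (partial_deriv W m \<Psi>)" using smooth_\<Psi>[of "Suc (Suc 0)"] by simp
  then have y2: "(y1 has_vector_derivative y2) (at t0)"
    unfolding y1_def y2_def using open_W z by (rule C_k_on_line)
  have yU: "y t \<in> U" if "z + t *\<^sub>R axis m 1 \<in> W" for t using \<Psi>_in[OF that] by (simp add: y_def)
  define x where "x = y t0"
  define b where "b = y1 t0"
  have x: "x \<in> U" using yU[OF z] by (simp add: x_def)
  have J_y1: "J (y t) (y1 t) = axis m 1" if t: "z + t *\<^sub>R axis m 1 \<in> W" for t
  proof -
    have "((\<lambda>t. \<Phi> (y t)) has_vector_derivative J (y t) (y1 t)) (at t)"
      unfolding J_def by (rule C_k_on_curve[OF smooth_\<Phi> open_U yU[OF t] y1[OF t]])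
    moreover have "\<forall>\<^sub>F s in nhds t. z + s *\<^sub>R axis m 1 \<in> W"
      using open_W t by (rule eventually_line_in_open)
    then have "\<forall>\<^sub>F s in nhds t. \<Phi> (y s) = z + s *\<^sub>R axis m 1"
      unfolding y_def by (rule eventually_mono) (rule \<Phi>_\<Psi>)
    ultimately have "((\<lambda>s. z + s *\<^sub>R axis m 1) has_vector_derivative J (y t) (y1 t)) (at t)"
      by (rule has_vector_derivative_transform_eventually)
    moreover have "((\<lambda>s. z + s *\<^sub>R axis m 1) has_vector_derivative axis m (1::real)) (at t)"
      by (rule has_vector_derivative_eq_rhs, (rule derivative_intros)+) simp
    ultimately show ?thesis by (rule vector_derivative_unique_at)
  qed
  \<comment> \<open>The image velocity is the constant \<open>axis m 1\<close>; differentiating this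
    yields the geodesic equation of \<open>y\<close>, solved for \<open>y2\<close> below.\<close>
  have "((\<lambda>t. J (y t) (y1 t)) has_vector_derivative
      J x y2 + (\<Sum>i\<in>UNIV. \<Sum>j\<in>UNIV. (b $ i * b $ j) *\<^sub>R E2 j i x)) (at t0)"
    unfolding J_def x_def b_def
    by (rule C_2_on_curve_second[OF smooth_\<Phi> open_U yU[OF z] y1[OF z] y2])
  moreover have "\<forall>\<^sub>F t in nhds t0. J (y t) (y1 t) = axis m 1"
    using evW by (rule eventually_mono) (rule J_y1)
  ultimately have "((\<lambda>t. axis m 1) has_vector_derivative
      J x y2 + (\<Sum>i\<in>UNIV. \<Sum>j\<in>UNIV. (b $ i * b $ j) *\<^sub>R E2 j i x)) (at t0)"
    by (rule has_vector_derivative_transform_eventually)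
  then have "J x y2 + (\<Sum>i\<in>UNIV. \<Sum>j\<in>UNIV. (b $ i * b $ j) *\<^sub>R E2 j i x) = 0"
    using vector_derivative_unique_at has_vector_derivative_const by blast
  then have "J x y2 = - (\<Sum>i\<in>UNIV. \<Sum>j\<in>UNIV. (b $ i * b $ j) *\<^sub>R E2 j i x)"
    by (rule eq_neg_iff_add_eq_0[THEN iffD2])
  then have "Q x (J x y2) = Q x (- (\<Sum>i\<in>UNIV. \<Sum>j\<in>UNIV. (b $ i * b $ j) *\<^sub>R E2 j i x))"
    by (rule arg_cong)
  then have y2_eq: "y2 $ k = - (\<Sum>i\<in>UNIV. \<Sum>j\<in>UNIV. b $ i * b $ j * \<Gamma> k j i x)" for k
    by (simp add: Q_J[OF x] linear_neg[OF linear_Q] linear_sum[OF linear_Q] linear_cmul[OF linear_Q]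
        christoffel_eq[OF x])
  have hessian_term: "partial_deriv U j (partial_deriv U i h) x - (\<Sum>k\<in>UNIV. \<Gamma> k j i x * partial_deriv U k h x)
      = \<mu> * G x $ j $ i" for i j
    using hess[OF x, of j i] by (simp add: hessian_def)
  \<comment> \<open>The geodesic equation turns the acceleration term into the Christoffel
    correction of the Hessian.\<close>
  have "(\<Sum>k\<in>UNIV. y2 $ k * partial_deriv U k h x)
      = - (\<Sum>k\<in>UNIV. \<Sum>i\<in>UNIV. \<Sum>j\<in>UNIV. b $ i * b $ j * (\<Gamma> k j i x * partial_deriv U k h x))"
    by (simp add: y2_eq sum_distrib_right sum_negf mult.assoc)
  also have "\<dots> = - (\<Sum>i\<in>UNIV. \<Sum>j\<in>UNIV. \<Sum>k\<in>UNIV. b $ i * b $ j * (\<Gamma> k j i x * partial_deriv U k h x))"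
    by (subst sum.swap, subst sum.swap) (rule refl)
  finally have "(\<Sum>k\<in>UNIV. y2 $ k * partial_deriv U k h x)
        + (\<Sum>i\<in>UNIV. \<Sum>j\<in>UNIV. b $ i * b $ j * partial_deriv U j (partial_deriv U i h) x)
      = (\<Sum>i\<in>UNIV. \<Sum>j\<in>UNIV. b $ i * b $ j * (partial_deriv U j (partial_deriv U i h) x
          - (\<Sum>k\<in>UNIV. \<Gamma> k j i x * partial_deriv U k h x)))"
    by (simp add: right_diff_distrib sum_subtractf sum_distrib_left)
  also have "\<dots> = \<mu> * (\<Sum>i\<in>UNIV. \<Sum>j\<in>UNIV. b $ i * b $ j * G x $ j $ i)"
    unfolding hessian_term by (simp add: sum_distrib_left algebra_simps)
  also have "(\<Sum>i\<in>UNIV. \<Sum>j\<in>UNIV. b $ i * b $ j * G x $ j $ i) = J x b \<bullet> J x b"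
    unfolding J_def by (simp add: G_eq[OF x] inner_sum_left inner_sum_right sum_distrib_left inner_commute algebra_simps)
  also have "J x b = axis m 1" using J_y1[OF z] by (simp add: x_def b_def)
  finally have second: "(\<Sum>k\<in>UNIV. y2 $ k * partial_deriv U k h x)
        + (\<Sum>i\<in>UNIV. \<Sum>j\<in>UNIV. b $ i * b $ j * partial_deriv U j (partial_deriv U i h) x) = \<mu>"
    by (simp add: inner_axis_axis)
  define \<phi>' where "\<phi>' t = (\<Sum>i\<in>UNIV. y1 t $ i *\<^sub>R partial_deriv U i h (y t))" for t
  have "(\<phi>' has_vector_derivative \<mu>) (at t0)"
    using C_2_on_curve_second[OF h open_U yU[OF z] y1[OF z] y2] second
    unfolding \<phi>'_def[abs_def] x_def b_def by simp
  moreover have "\<forall>\<^sub>F t in nhds t0. ((\<lambda>t. h (y t)) has_real_derivative \<phi>' t) (at t)"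
    using evW unfolding \<phi>'_def has_real_derivative_iff_has_vector_derivative
    by (rule eventually_mono) (intro C_k_on_curve[OF h open_U] yU y1)
  ultimately show ?thesis
    unfolding y_def has_real_derivative_iff_has_vector_derivative[symmetric] by blast
qed

end

section \<open>Curves on spheres and auxiliary calculus\<close>

text \<open>The angle \<open>arccos (u t)\<close> between \<open>\<gamma> t\<close> and
  \<open>\<gamma> 0\<close> has to grow from 0 to \<open>pi\<close>, and its rate of growth is at
  most \<open>s / r\<close>.\<close>

lemma antipodal_arc_length:
  fixes \<gamma> :: "real \<Rightarrow> 'a::real_inner"
  assumes r: "0 < r" and \<alpha>: "0 \<le> \<alpha>"
    and on_sphere: "\<And>t. norm (\<gamma> t) = r"
    and deriv: "\<And>t. (\<gamma> has_vector_derivative \<gamma>' t) (at t)"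
    and speed: "\<And>t. norm (\<gamma>' t) \<le> s"
    and antipodal: "\<gamma> \<alpha> = - \<gamma> 0"
  shows "pi * r \<le> s * \<alpha>"
proof -
  define u where "u t = \<gamma> t \<bullet> \<gamma> 0 / r\<^sup>2" for t
  have sq: "\<gamma> t \<bullet> \<gamma> t = r\<^sup>2" for t using on_sphere[of t] by (simp add: power2_norm_eq_inner[symmetric])
  have u_bound: "-1 \<le> u t" "u t \<le> 1" for t
  proof -
    have "\<bar>\<gamma> t \<bullet> \<gamma> 0\<bar> \<le> r\<^sup>2"
      using Cauchy_Schwarz_ineq2[of "\<gamma> t" "\<gamma> 0"] by (simp add: on_sphere power2_eq_square)
    then show "-1 \<le> u t" "u t \<le> 1" using r unfolding u_def by (auto simp: field_simps abs_le_iff)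
  qed
  have u0: "u 0 = 1" and u\<alpha>: "u \<alpha> = -1" using r by (simp_all add: u_def sq antipodal)
  have u': "(u has_real_derivative \<gamma>' t \<bullet> \<gamma> 0 / r\<^sup>2) (at t)" for t
    unfolding u_def has_real_derivative_iff_has_vector_derivative
    by (intro has_vector_derivative_divide
        bounded_linear.has_vector_derivative[OF bounded_linear_inner_left] deriv)
  then have cont: "continuous_on A u" for A
    by (meson DERIV_isCont continuous_at_imp_continuous_on)
  \<comment> \<open>\<open>arccos\<close> is not differentiable at 1 and -1. Let \<open>t1\<close>
    be the first time at the antipode and \<open>t0\<close> the last time before it at the starting
    point; strictly between them \<open>u\<close> avoids both values.\<close>
  have "compact ({0..\<alpha>} \<inter> u -` {-1})"
    using cont by (intro compact_Int_closed compact_Icc closed_vimage) auto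
  moreover have "\<alpha> \<in> {0..\<alpha>} \<inter> u -` {-1}" using \<alpha> u\<alpha> by simp
  ultimately obtain t1 where "t1 \<in> {0..\<alpha>} \<inter> u -` {-1}" "\<forall>t\<in>{0..\<alpha>} \<inter> u -` {-1}. t1 \<le> t"
    using compact_attains_inf by (metis empty_iff)
  then have t1: "t1 \<in> {0..\<alpha>}" "u t1 = -1" "\<And>t. t \<in> {0..\<alpha>} \<Longrightarrow> u t = -1 \<Longrightarrow> t1 \<le> t"
    by auto
  have "compact ({0..t1} \<inter> u -` {1})"
    using cont by (intro compact_Int_closed compact_Icc closed_vimage) auto
  moreover have "0 \<in> {0..t1} \<inter> u -` {1}" using t1 u0 by simp
  ultimately obtain t0 where "t0 \<in> {0..t1} \<inter> u -` {1}" "\<forall>t\<in>{0..t1} \<inter> u -` {1}. t \<le> t0"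
    using compact_attains_sup by (metis empty_iff)
  then have t0: "t0 \<in> {0..t1}" "u t0 = 1" "\<And>t. t \<in> {0..t1} \<Longrightarrow> u t = 1 \<Longrightarrow> t \<le> t0"
    by auto
  have "t0 \<noteq> t1" using t0(2) t1(2) by auto
  then have "t0 < t1" using t0(1) by simp
  have strict: "-1 < u t" "u t < 1" if t: "t0 < t" "t < t1" for t
  proof -
    have "u t \<noteq> -1" "u t \<noteq> 1" using t0(1) t1(1) t0(3)[of t] t1(3)[of t] t by auto
    then show "-1 < u t" "u t < 1" using u_bound[of t] by auto
  qed
  let ?d = "\<lambda>t. inverse (- sqrt (1 - (u t)\<^sup>2)) * (\<gamma>' t \<bullet> \<gamma> 0 / r\<^sup>2)"
  have der: "((\<lambda>t. arccos (u t)) has_real_derivative ?d t) (at t)" if "t0 < t" "t < t1" for t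
    using DERIV_chain2[OF DERIV_arccos[OF strict[OF that]] u'] .
  have "continuous_on {t0..t1} (\<lambda>t. arccos (u t))"
    by (intro continuous_on_arccos cont) (use u_bound in auto)
  then obtain t where t: "t0 < t" "t < t1" "arccos (u t1) - arccos (u t0) = ?d t * (t1 - t0)"
    using mvt[OF \<open>t0 < t1\<close>, of "\<lambda>t. arccos (u t)" "\<lambda>t. (*) (?d t)"] der
    unfolding has_field_derivative_def by (metis greaterThanLessThan_iff)
  have orth: "\<gamma>' t \<bullet> \<gamma> t = 0"
  proof -
    have "((\<lambda>t. \<gamma> t \<bullet> \<gamma> t) has_vector_derivative \<gamma> t \<bullet> \<gamma>' t + \<gamma>' t \<bullet> \<gamma> t) (at t)"
      by (rule bounded_bilinear.has_vector_derivative[OF bounded_bilinear_inner deriv deriv])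
    then have "((\<lambda>t. r\<^sup>2) has_vector_derivative \<gamma> t \<bullet> \<gamma>' t + \<gamma>' t \<bullet> \<gamma> t) (at t)"
      by (simp add: sq)
    then have "\<gamma> t \<bullet> \<gamma>' t + \<gamma>' t \<bullet> \<gamma> t = 0"
      by (rule vector_derivative_unique_at) (rule has_vector_derivative_const)
    then show ?thesis by (simp add: inner_commute)
  qed
  \<comment> \<open>\<open>q\<close> is the sine of the angle. The derivative of
    \<open>arccos\<close> contributes \<open>1 / q\<close>; since the velocity is tangential, only
    the component of \<open>\<gamma> 0\<close> orthogonal to \<open>\<gamma> t\<close> counts, and
    its norm \<open>r * q\<close> cancels the singular factor.\<close>
  define q where "q = sqrt (1 - (u t)\<^sup>2)"
  have "1 - (u t)\<^sup>2 > 0" using strict[OF t(1,2)] by (simp add: abs_square_less_1 abs_less_iff)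
  then have q: "q > 0" "q\<^sup>2 = 1 - (u t)\<^sup>2" by (simp_all add: q_def)
  have "\<gamma> t \<bullet> \<gamma> 0 = u t * r\<^sup>2" using r by (simp add: u_def)
  then have "(norm (\<gamma> 0 - u t *\<^sub>R \<gamma> t))\<^sup>2 = (r * q)\<^sup>2"
    unfolding power2_norm_eq_inner power_mult_distrib q(2)
    by (simp add: inner_diff_left inner_diff_right sq inner_commute[of "\<gamma> 0"] algebra_simps power2_eq_square)
  then have nrm: "norm (\<gamma> 0 - u t *\<^sub>R \<gamma> t) = r * q"
    using r q by (simp add: power2_eq_iff_nonneg)
  have "\<gamma>' t \<bullet> \<gamma> 0 = \<gamma>' t \<bullet> (\<gamma> 0 - u t *\<^sub>R \<gamma> t)" by (simp add: inner_diff_right orth)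
  then have "\<bar>\<gamma>' t \<bullet> \<gamma> 0\<bar> \<le> norm (\<gamma>' t) * (r * q)"
    using Cauchy_Schwarz_ineq2[of "\<gamma>' t" "\<gamma> 0 - u t *\<^sub>R \<gamma> t"] by (simp add: nrm)
  also have "\<dots> \<le> s * (r * q)" using speed[of t] r q by (intro mult_right_mono) auto
  finally have bound: "\<bar>\<gamma>' t \<bullet> \<gamma> 0\<bar> \<le> s * (r * q)" .
  have "s \<ge> 0" using speed[of 0] norm_ge_zero order_trans by blast
  have "?d t \<le> s / r"
  proof -
    have "?d t = (- (\<gamma>' t \<bullet> \<gamma> 0)) / (q * r\<^sup>2)" using q r by (simp add: q_def[symmetric] field_simps)
    also have "\<dots> \<le> s * (r * q) / (q * r\<^sup>2)" using bound q r by (intro divide_right_mono) auto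
    also have "\<dots> = s / r" using q r by (simp add: power2_eq_square)
    finally show ?thesis .
  qed
  then have "pi \<le> s / r * (t1 - t0)"
    using t(3) t1(2) t0(2) \<open>t0 < t1\<close> mult_right_mono[of "?d t" "s/r" "t1 - t0"] by simp
  also have "\<dots> \<le> s / r * \<alpha>" using t0 t1 \<open>s \<ge> 0\<close> r by (intro mult_left_mono) auto
  finally show ?thesis using r by (simp add: field_simps)
qed

text \<open>\<open>w\<close> is the normalised component of \<open>v\<close> orthogonal to
  \<open>u\<close>. If that component vanishes, any unit vector orthogonal to \<open>u\<close> will
  do, and its existence is where \<open>dim\<close> enters.\<close>

lemma unit_vector_on_great_circle:
  fixes u v :: "'a::euclidean_space"
  assumes dim: "DIM('a) \<ge> 2" and u: "norm u = 1" and v: "norm v = 1"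
  obtains w \<alpha> where "norm w = 1" "u \<bullet> w = 0" "0 \<le> \<alpha>" "\<alpha> \<le> pi" "v = cos \<alpha> *\<^sub>R u + sin \<alpha> *\<^sub>R w"
proof -
  define c where "c = v \<bullet> u"
  have uu: "u \<bullet> u = 1" and vv: "v \<bullet> v = 1" using u v by (simp_all add: norm_eq_1)
  have c: "-1 \<le> c" "c \<le> 1" using Cauchy_Schwarz_ineq2[of v u] u v by (auto simp: c_def abs_le_iff)
  define p where "p = v - c *\<^sub>R u"
  have up: "u \<bullet> p = 0" by (simp add: p_def inner_diff_right uu c_def inner_commute)
  have "p \<bullet> p = 1 - c\<^sup>2"
    by (simp add: p_def inner_diff_left inner_diff_right uu vv c_def inner_commute power2_eq_square)
  then have np: "norm p = sin (arccos c)" using c by (simp add: norm_eq_sqrt_inner sin_arccos)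
  obtain w where w: "norm w = 1" "u \<bullet> w = 0" "p = norm p *\<^sub>R w"
  proof (cases "p = 0")
    case True
    obtain y where y: "y \<noteq> 0" "orthogonal u y" using orthogonal_to_vector_exists[OF dim] by blast
    show ?thesis
      by (rule that[of "y /\<^sub>R norm y"]) (use y True in \<open>auto simp: orthogonal_def\<close>)
  next
    case False
    then show ?thesis by (intro that[of "p /\<^sub>R norm p"]) (use up in auto)
  qed
  show ?thesis
  proof (rule that[OF w(1,2), of "arccos c"])
    have "v = c *\<^sub>R u + p" by (simp add: p_def)
    then show "v = cos (arccos c) *\<^sub>R u + sin (arccos c) *\<^sub>R w"
      using w(3) c by (simp add: np)
  qed (use c arccos_lbound arccos_ubound in auto)
qed

text \<open>Subtracting the parabola with second derivative \<open>\<mu>\<close> and the same zeros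
  leaves a function of constant slope that vanishes at both ends. At the ends only continuity is
  assumed, because derivatives of the potential are computed in the open ball.\<close>

lemma constant_second_derivative_midpoint:
  fixes \<phi> :: "real \<Rightarrow> real"
  assumes \<rho>: "0 < \<rho>" and cont: "continuous_on {-\<rho>..\<rho>} \<phi>" and ends: "\<phi> (-\<rho>) = 0" "\<phi> \<rho> = 0"
    and second: "\<And>t. -\<rho> < t \<Longrightarrow> t < \<rho> \<Longrightarrow>
      \<exists>\<phi>'. (\<forall>\<^sub>F s in nhds t. (\<phi> has_real_derivative \<phi>' s) (at s)) \<and> (\<phi>' has_real_derivative \<mu>) (at t)"
  shows "\<phi> 0 = - \<mu> * \<rho>\<^sup>2 / 2"
proof -
  \<comment> \<open>The first derivatives in \<open>second\<close> may depend on \<open>t\<close>;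
    each agrees with \<open>deriv \<phi>\<close> near its point, which glues them into one
    function.\<close>
  define d where "d = deriv \<phi>"
  have d: "(\<phi> has_real_derivative d t) (at t)" "(d has_real_derivative \<mu>) (at t)"
    if t: "-\<rho> < t" "t < \<rho>" for t
  proof -
    obtain \<phi>' where ev: "\<forall>\<^sub>F s in nhds t. (\<phi> has_real_derivative \<phi>' s) (at s)"
      and \<phi>': "(\<phi>' has_real_derivative \<mu>) (at t)" using second[OF t] by blast
    have eq: "\<forall>\<^sub>F s in nhds t. \<phi>' s = d s"
      using ev by (rule eventually_mono) (simp add: d_def DERIV_imp_deriv)
    have "\<phi>' t = d t" using eq by (rule eventually_nhds_x_imp_x)
    then show "(\<phi> has_real_derivative d t) (at t)" using eventually_nhds_x_imp_x[OF ev] by simp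
    show "(d has_real_derivative \<mu>) (at t)"
      using \<phi>' DERIV_cong_ev[OF refl eq refl] by blast
  qed
  define \<psi> where "\<psi> t = \<phi> t - \<mu> / 2 * (t\<^sup>2 - \<rho>\<^sup>2)" for t
  have \<psi>': "(\<psi> has_real_derivative d t - \<mu> * t) (at t)" if "-\<rho> < t" "t < \<rho>" for t
    unfolding \<psi>_def by (rule derivative_eq_intros d that refl | simp)+
  have \<psi>'': "((\<lambda>t. d t - \<mu> * t) has_real_derivative 0) (at t)" if "-\<rho> < t" "t < \<rho>" for t
    by (rule derivative_eq_intros d that refl | simp)+
  have const: "d a - \<mu> * a = d b - \<mu> * b" if "-\<rho> < a" "a < \<rho>" "-\<rho> < b" "b < \<rho>" for a b
    using DERIV_isconst3[of "-\<rho>" \<rho> a b "\<lambda>t. d t - \<mu> * t"] \<psi>'' that \<rho> by auto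
  have cont\<psi>: "continuous_on {-\<rho>..\<rho>} \<psi>"
    unfolding \<psi>_def[abs_def] by (intro continuous_intros cont)
  have c1: "continuous_on {-\<rho>..0} \<psi>" and c2: "continuous_on {0..\<rho>} \<psi>"
    using \<rho> by (auto intro: continuous_on_subset[OF cont\<psi>])
  obtain a where a: "-\<rho> < a" "a < 0" "\<psi> 0 - \<psi> (-\<rho>) = (d a - \<mu> * a) * (0 - - \<rho>)"
    using mvt[OF _ c1, of "\<lambda>t. (*) (d t - \<mu> * t)"] \<psi>' \<rho>
    unfolding has_field_derivative_def by (metis greaterThanLessThan_iff less_trans neg_less_0_iff_less)
  obtain b where b: "0 < b" "b < \<rho>" "\<psi> \<rho> - \<psi> 0 = (d b - \<mu> * b) * (\<rho> - 0)"
    using mvt[OF _ c2, of "\<lambda>t. (*) (d t - \<mu> * t)"] \<psi>' \<rho>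
    unfolding has_field_derivative_def by (metis greaterThanLessThan_iff less_trans neg_less_0_iff_less)
  have "\<psi> \<rho> - \<psi> 0 = \<psi> 0 - \<psi> (-\<rho>)"
    using a b const[of a b] \<rho> by simp
  moreover have "\<psi> \<rho> = 0" "\<psi> (-\<rho>) = 0" by (simp_all add: \<psi>_def ends)
  ultimately have "\<psi> 0 = 0" by simp
  then show ?thesis by (simp add: \<psi>_def)
qed

lemma trace_matrix_inv:
  fixes G :: "real^'n::finite^'n"
  assumes inv: "matrix_inv G ** G = mat 1" and sym: "transpose G = G"
  shows "(\<Sum>i\<in>UNIV. \<Sum>j\<in>UNIV. matrix_inv G $ i $ j * G $ i $ j) = real CARD('n)"
proof -
  have "G $ i $ j = G $ j $ i" for i j
    using sym by (metis transpose_def vec_lambda_beta)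
  then have "(\<Sum>i\<in>UNIV. \<Sum>j\<in>UNIV. matrix_inv G $ i $ j * G $ i $ j)
      = (\<Sum>i\<in>UNIV. (matrix_inv G ** G) $ i $ i)"
    by (simp add: matrix_matrix_mult_def)
  also have "\<dots> = real CARD('n)" by (simp add: inv mat_def)
  finally show ?thesis .
qed

section \<open>Manifolds isometric to a Euclidean ball\<close>

lemma christoffel_open_subset:
  assumes "open U" "U \<subseteq> S" "x \<in> U"
  shows "christoffel S G k (i::'n::finite) j x = christoffel U G k i j x"
proof -
  have "partial_deriv S i h x = partial_deriv U i h x" for i and h :: "real^'n \<Rightarrow> real"
    using assms(1,3,2) refl by (rule partial_deriv_cong_open)
  then show ?thesis by (simp add: christoffel_def)
qed

lemma riemann_open_subset:
  assumes U: "open U" "U \<subseteq> S" "x \<in> U"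
  shows "riemann S G l k i j x = riemann U G l k i j x"
proof -
  have "partial_deriv S i (christoffel S G l j k) x = partial_deriv U i (christoffel U G l j k) x" for i j
    using U by (intro partial_deriv_cong_open christoffel_open_subset)
  then show ?thesis by (simp add: riemann_def christoffel_open_subset[OF U])
qed

lemma ricci_open_subset:
  assumes "open U" "U \<subseteq> S" "x \<in> U"
  shows "ricci S G i j x = ricci U G i j x"
  by (simp add: ricci_def riemann_open_subset[OF assms])

lemma hessian_open_subset:
  assumes U: "open U" "U \<subseteq> S" "x \<in> U"
  shows "hessian S G h i j x = hessian U G h i j x"
proof -
  have eq: "partial_deriv S j h y = partial_deriv U j h y" if "y \<in> U" for j y
    using U that by (intro partial_deriv_cong_open) auto
  have "partial_deriv S i (partial_deriv S j h) x = partial_deriv U i (partial_deriv U j h) x"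
    using U by (intro partial_deriv_cong_open eq)
  then show ?thesis by (simp add: hessian_def christoffel_open_subset[OF U] eq[OF U(3)])
qed

section \<open>Smooth maps along curves that may run inside the boundary\<close>

lemma isCont_eventually_in_open:
  assumes "isCont f t" "open S" "f t \<in> S"
  shows "\<forall>\<^sub>F s in nhds t. f s \<in> S"
  using assms by (simp add: continuous_at tendsto_at_iff_tendsto_nhds topological_tendstoD)

text \<open>At the edge of the half-space \<open>H\<close> has no two-sided derivative, but a curve
  that stays in \<open>S\<close> only sees values where \<open>H\<close> and its extension
  agree.\<close>

lemma smooth_on_curve_extension:
  assumes H: "smooth_on S H" and y: "\<forall>\<^sub>F t in nhds t0. y t \<in> S"
    and y': "(y has_vector_derivative y') (at t0)"
  obtains V e where "open V" "y t0 \<in> V" "\<And>k. C_k_on k V e" "\<And>x. x \<in> S \<Longrightarrow> x \<in> V \<Longrightarrow> e x = H x"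
    "((\<lambda>t. H (y t)) has_vector_derivative (\<Sum>i\<in>UNIV. y' $ i *\<^sub>R partial_deriv V i e (y t0))) (at t0)"
proof -
  have "y t0 \<in> S" using y by (rule eventually_nhds_x_imp_x)
  obtain V e where V: "open V" "y t0 \<in> V" "\<And>k. C_k_on k V e" "\<And>x. x \<in> S \<Longrightarrow> x \<in> V \<Longrightarrow> e x = H x"
    by (rule smooth_onE[OF H \<open>y t0 \<in> S\<close>], rule that)
  have "isCont y t0" using y' by (rule has_vector_derivative_continuous)
  then have "\<forall>\<^sub>F t in nhds t0. y t \<in> V"
    using V(1,2) by (rule isCont_eventually_in_open)
  with y have "\<forall>\<^sub>F t in nhds t0. e (y t) = H (y t)"
    by eventually_elim (rule V(4))
  then have "((\<lambda>t. H (y t)) has_vector_derivative (\<Sum>i\<in>UNIV. y' $ i *\<^sub>R partial_deriv V i e (y t0))) (at t0)"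
    by (rule has_vector_derivative_transform_eventually[OF C_k_on_curve[OF V(3,1,2) y']])
  with V show thesis by (rule that)
qed

text \<open>Only the coordinate directions present in the velocity must stay in \<open>S\<close>.
  This admits curves in the boundary: their velocity has no component along the normal line, which
  leaves \<open>S\<close>.\<close>

lemma smooth_on_curve:
  assumes H: "smooth_on S H" and y: "\<forall>\<^sub>F t in nhds t0. y t \<in> S"
    and y': "(y has_vector_derivative y') (at t0)"
    and lines: "\<And>i. y' $ i \<noteq> 0 \<Longrightarrow> \<forall>\<^sub>F t in nhds 0. y t0 + t *\<^sub>R axis i 1 \<in> S"
  shows "((\<lambda>t. H (y t)) has_vector_derivative (\<Sum>i\<in>UNIV. y' $ i *\<^sub>R partial_deriv S i H (y t0))) (at t0)"
proof -
  obtain V e where V: "open V" "y t0 \<in> V" "\<And>k. C_k_on k V e" "\<And>x. x \<in> S \<Longrightarrow> x \<in> V \<Longrightarrow> e x = H x"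
    and d: "((\<lambda>t. H (y t)) has_vector_derivative (\<Sum>i\<in>UNIV. y' $ i *\<^sub>R partial_deriv V i e (y t0))) (at t0)"
    by (rule smooth_on_curve_extension[OF H y y'], rule that)
  have "y' $ i *\<^sub>R partial_deriv V i e (y t0) = y' $ i *\<^sub>R partial_deriv S i H (y t0)" for i
  proof (cases "y' $ i = 0")
    case False
    have inV: "\<forall>\<^sub>F t in nhds 0. y t0 + t *\<^sub>R axis i 1 \<in> V"
      using V(1,2) by (intro eventually_line_in_open) auto
    with lines[OF False] have "\<forall>\<^sub>F t in nhds 0. H (y t0 + t *\<^sub>R axis i 1) = e (y t0 + t *\<^sub>R axis i 1)"
      by eventually_elim (simp add: V(4))
    from has_derivative_imp_partial_deriv[OF C_k_on_has_derivative[OF V(3,1,2)] lines[OF False] this]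
    show ?thesis by (simp add: sum_axis_scaleR)
  qed simp
  then have "(\<Sum>i\<in>UNIV. y' $ i *\<^sub>R partial_deriv V i e (y t0))
      = (\<Sum>i\<in>UNIV. y' $ i *\<^sub>R partial_deriv S i H (y t0))"
    by (rule sum.cong[OF refl])
  with d show ?thesis by (simp only:)
qed

text \<open>Norms depend only on the Gram matrix. Restricting to \<open>I\<close> matters because
  the two isometries compared later share their Gram matrix only in the tangential indices.\<close>

lemma norm_sum_scaleR_eq:
  fixes a b :: "'i \<Rightarrow> 'b::real_inner"
  assumes "\<And>i j. i \<in> I \<Longrightarrow> j \<in> I \<Longrightarrow> a i \<bullet> a j = b i \<bullet> b j" "\<And>i. i \<notin> I \<Longrightarrow> c i = 0"
  shows "norm (\<Sum>i\<in>S. c i *\<^sub>R a i) = norm (\<Sum>i\<in>S. c i *\<^sub>R b i)"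
proof -
  have eq: "c i * (c j * (a j \<bullet> a i)) = c i * (c j * (b j \<bullet> b i))" for i j
    using assms by (cases "i \<in> I"; cases "j \<in> I") auto
  have "(\<Sum>i\<in>S. c i *\<^sub>R v i) \<bullet> (\<Sum>i\<in>S. c i *\<^sub>R v i) = (\<Sum>i\<in>S. \<Sum>j\<in>S. c i * (c j * (v j \<bullet> v i)))"
    for v :: "'i \<Rightarrow> 'b"
    by (simp add: inner_sum_left inner_sum_right sum_distrib_left)
  then show ?thesis unfolding norm_eq by (simp only: eq)
qed

lemma riemannian_isometryD:
  assumes "riemannian_isometry X A g D I N F"
  shows "homeomorphic_map (subtopology X D) (top_of_set N) F"
    and "c \<in> A \<Longrightarrow> smooth_on (snd c ` (fst c \<inter> D)) (F \<circ> chart_inv c)"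
    and "c \<in> A \<Longrightarrow> smooth_on (F ` (fst c \<inter> D)) (snd c \<circ> inv_into D F)"
    and "c \<in> A \<Longrightarrow> x \<in> snd c ` (fst c \<inter> D) \<Longrightarrow> i \<in> I \<Longrightarrow> j \<in> I \<Longrightarrow>
      partial_deriv (snd c ` (fst c \<inter> D)) i (F \<circ> chart_inv c) x \<bullet>
      partial_deriv (snd c ` (fst c \<inter> D)) j (F \<circ> chart_inv c) x = g c x $ i $ j"
proof -
  note iso = assms[unfolded riemannian_isometry_def]
  show "homeomorphic_map (subtopology X D) (top_of_set N) F" using iso by (rule conjunct1)
  show "smooth_on (snd c ` (fst c \<inter> D)) (F \<circ> chart_inv c)" if "c \<in> A"
    using iso[THEN conjunct2, THEN conjunct1, THEN bspec, OF that] by (rule conjunct1)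
  show "smooth_on (F ` (fst c \<inter> D)) (snd c \<circ> inv_into D F)" if "c \<in> A"
    using iso[THEN conjunct2, THEN conjunct1, THEN bspec, OF that] by (rule conjunct2)
  show "partial_deriv (snd c ` (fst c \<inter> D)) i (F \<circ> chart_inv c) x \<bullet>
      partial_deriv (snd c ` (fst c \<inter> D)) j (F \<circ> chart_inv c) x = g c x $ i $ j"
    if "c \<in> A" "x \<in> snd c ` (fst c \<inter> D)" "i \<in> I" "j \<in> I"
    by (rule iso[THEN conjunct2, THEN conjunct2, THEN bspec, OF that(1), THEN bspec, OF that(2),
        THEN bspec, OF that(3), THEN bspec, OF that(4)])
qed

locale ball_isometry =
  fixes X :: "'a topology" and A :: "('a, 'n::finite) chart set" and g :: "('a, 'n) metric"
    and F :: "'a \<Rightarrow> real^'n" and z0 :: "real^'n" and \<rho> :: real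
  assumes manifold: "smooth_manifold_with_boundary X A"
    and radius_pos: "0 < \<rho>"
    and isometry: "riemannian_isometry X A g (topspace X) UNIV (cball z0 \<rho>) F"
begin

section \<open>The isometry and its inverse in charts\<close>

definition Finv where "Finv = inv_into (topspace X) F"

definition \<Phi> where "\<Phi> c = F \<circ> chart_inv c"

definition \<Psi> where "\<Psi> c = snd c \<circ> Finv"

text \<open>The interior part of a chart is cut out by the normal coordinate, its counterpart
  \<open>W\<close> by the open ball; that \<open>\<Phi> c\<close> carries one to the other is
  \<open>interior_iff\<close>.\<close>

definition U :: "('a, 'n) chart \<Rightarrow> (real^'n) set"
  where "U c = chart_image c \<inter> {x. 0 < x $ normal_index}"

definition W where "W c = F ` fst c \<inter> ball z0 \<rho>"

lemma homeo: "homeomorphic_map X (top_of_set (cball z0 \<rho>)) F"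
  using riemannian_isometryD(1)[OF isometry] by simp

lemma F_image: "F ` topspace X = cball z0 \<rho>"
  using homeomorphic_imp_surjective_map[OF homeo] by simp

lemma F_inj: "inj_on F (topspace X)"
  using homeo by (rule homeomorphic_imp_injective_map)

lemma Finv_F: "p \<in> topspace X \<Longrightarrow> Finv (F p) = p"
  unfolding Finv_def using F_inj by (rule inv_into_f_f)

lemma F_Finv: "z \<in> cball z0 \<rho> \<Longrightarrow> F (Finv z) = z"
  and Finv_in: "z \<in> cball z0 \<rho> \<Longrightarrow> Finv z \<in> topspace X"
  unfolding Finv_def F_image[symmetric] by (rule f_inv_into_f inv_into_into; assumption)+

lemma chart_cover:
  assumes "p \<in> topspace X"
  shows "\<exists>c\<in>A. p \<in> fst c"
proof -
  have "(\<Union>c\<in>A. fst c) = topspace X"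
    using manifold by (simp add: smooth_manifold_with_boundary_def)
  then show ?thesis using assms by blast
qed

context
  fixes c assumes c: "c \<in> A"
begin

lemma chart: "is_chart X c"
  using manifold c by (simp add: smooth_manifold_with_boundary_def)

lemma chart_domain: "fst c \<subseteq> topspace X"
  using chart by (simp add: is_chart_def openin_subset)

lemma inter_topspace: "fst c \<inter> topspace X = fst c"
  using chart_domain by auto

lemma chart_inj: "inj_on (snd c) (fst c)"
proof -
  have "homeomorphic_map (subtopology X (fst c)) (top_of_set (chart_image c)) (snd c)"
    using chart by (simp add: is_chart_def)
  then have "inj_on (snd c) (topspace (subtopology X (fst c)))"
    by (rule homeomorphic_imp_injective_map)
  then show ?thesis using chart_domain by (simp add: inf.absorb2)
qed

lemma chart_inv_chart: "p \<in> fst c \<Longrightarrow> chart_inv c (snd c p) = p"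
  unfolding chart_inv_def using chart_inj by (rule inv_into_f_f)

lemma chart_inv_in: "x \<in> chart_image c \<Longrightarrow> chart_inv c x \<in> fst c"
  and chart_chart_inv: "x \<in> chart_image c \<Longrightarrow> snd c (chart_inv c x) = x"
  unfolding chart_inv_def chart_image_def by (rule f_inv_into_f inv_into_into; assumption)+

lemma chart_image_open: obtains O' where "open O'" "chart_image c = O' \<inter> half_space"
proof -
  have "openin (top_of_set half_space) (chart_image c)" using chart by (simp add: is_chart_def)
  then obtain O' where "open O'" "chart_image c = half_space \<inter> O'" unfolding openin_open by (elim exE conjE)
  then show thesis by (intro that[of O']) (simp_all add: Int_commute)
qed

lemma chart_image_half_space: "chart_image c \<subseteq> half_space"
  using chart unfolding is_chart_def by (auto dest: openin_imp_subset)

lemma open_U: "open (U c)"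
proof -
  obtain O' where O': "open O'" "chart_image c = O' \<inter> half_space" by (rule chart_image_open)
  have "{x :: real^'n. 0 < x $ normal_index} \<subseteq> half_space" by (auto simp: half_space_def)
  then have "U c = O' \<inter> {x. 0 < x $ normal_index}" unfolding U_def O'(2) by blast
  moreover have "open {x :: real^'n. 0 < x $ normal_index}" by (intro open_Collect_less continuous_intros)
  ultimately show ?thesis using O'(1) by (simp only: open_Int)
qed

lemma F_chart_open: obtains O' where "open O'" "F ` fst c = O' \<inter> cball z0 \<rho>"
proof -
  have "openin X (fst c)" using chart by (simp add: is_chart_def)
  then have "openin (top_of_set (cball z0 \<rho>)) (F ` fst c)"
    using homeomorphic_imp_open_map[OF homeo] by (simp add: open_map_def)
  then obtain O' where "open O'" "F ` fst c = cball z0 \<rho> \<inter> O'" unfolding openin_open by (elim exE conjE)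
  then show thesis by (intro that[of O']) (simp_all add: Int_commute)
qed

lemma open_W: "open (W c)"
proof -
  obtain O' where O': "open O'" "F ` fst c = O' \<inter> cball z0 \<rho>" by (rule F_chart_open)
  have "W c = O' \<inter> ball z0 \<rho>" unfolding W_def O'(2) by auto
  then show ?thesis using O'(1) by (simp only: open_Int open_ball)
qed

lemma smooth_\<Phi>: "smooth_on (chart_image c) (\<Phi> c)"
  using riemannian_isometryD(2)[OF isometry c] by (simp add: inter_topspace chart_image_def \<Phi>_def)

lemma smooth_\<Psi>: "smooth_on (F ` fst c) (\<Psi> c)"
  using riemannian_isometryD(3)[OF isometry c] by (simp add: inter_topspace \<Psi>_def Finv_def)

lemma Finv_F_chart: "p \<in> fst c \<Longrightarrow> Finv (F p) = p"
  using chart_domain by (intro Finv_F) (rule subsetD)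

lemma \<Phi>_in: "x \<in> chart_image c \<Longrightarrow> \<Phi> c x \<in> F ` fst c"
  by (simp add: \<Phi>_def chart_inv_in)

lemma \<Psi>_in: "z \<in> F ` fst c \<Longrightarrow> \<Psi> c z \<in> chart_image c"
  by (erule imageE) (simp add: \<Psi>_def chart_image_def Finv_F_chart)

lemma \<Psi>_\<Phi>: "x \<in> chart_image c \<Longrightarrow> \<Psi> c (\<Phi> c x) = x"
  by (simp add: \<Psi>_def \<Phi>_def Finv_F_chart chart_inv_in chart_chart_inv)

lemma \<Phi>_\<Psi>: "z \<in> F ` fst c \<Longrightarrow> \<Phi> c (\<Psi> c z) = z"
  by (erule imageE) (simp add: \<Psi>_def \<Phi>_def Finv_F_chart chart_inv_chart)

lemma chart_inv_\<Psi>: "z \<in> F ` fst c \<Longrightarrow> chart_inv c (\<Psi> c z) = Finv z"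
  by (erule imageE) (simp add: \<Psi>_def Finv_F_chart chart_inv_chart)

text \<open>Invariance of domain, used in both directions: \<open>\<Phi> c\<close> maps
  \<open>U c\<close> onto an open set inside the closed ball, hence inside its interior, and
  \<open>\<Psi> c\<close> maps \<open>W c\<close> onto an open set inside the half-space.\<close>

lemma interior_iff:
  assumes x: "x \<in> chart_image c"
  shows "0 < x $ normal_index \<longleftrightarrow> \<Phi> c x \<in> ball z0 \<rho>"
proof
  assume "0 < x $ normal_index"
  then have "x \<in> U c" using x by (simp add: U_def)
  have "open (\<Phi> c ` U c)"
  proof (rule invariance_of_domain[OF _ open_U])
    show "continuous_on (U c) (\<Phi> c)"
      using smooth_on_imp_continuous_on[OF smooth_\<Phi>] by (rule continuous_on_subset) (auto simp: U_def)
    show "inj_on (\<Phi> c) (U c)" by (rule inj_on_inverseI[of _ "\<Psi> c"]) (simp add: U_def \<Psi>_\<Phi>)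
  qed
  moreover have "\<Phi> c ` U c \<subseteq> cball z0 \<rho>"
    using \<Phi>_in F_image chart_domain unfolding U_def by blast
  ultimately have "\<Phi> c ` U c \<subseteq> interior (cball z0 \<rho>)" by (rule interior_maximal[rotated])
  then show "\<Phi> c x \<in> ball z0 \<rho>" using \<open>x \<in> U c\<close> by auto
next
  assume "\<Phi> c x \<in> ball z0 \<rho>"
  then have xW: "\<Phi> c x \<in> W c" using \<Phi>_in[OF x] by (simp add: W_def)
  have "open (\<Psi> c ` W c)"
  proof (rule invariance_of_domain[OF _ open_W])
    show "continuous_on (W c) (\<Psi> c)"
      using smooth_on_imp_continuous_on[OF smooth_\<Psi>] by (rule continuous_on_subset) (auto simp: W_def)
    show "inj_on (\<Psi> c) (W c)" by (rule inj_on_inverseI[of _ "\<Phi> c"]) (simp add: W_def \<Phi>_\<Psi>)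
  qed
  moreover have "\<Psi> c ` W c \<subseteq> half_space"
    using \<Psi>_in chart_image_half_space unfolding W_def by blast
  ultimately have "\<Psi> c ` W c \<subseteq> interior half_space" by (rule interior_maximal[rotated])
  moreover have "interior half_space = {x :: real^'n. 0 < x $ normal_index}"
    unfolding half_space_def using interior_halfspace_component_ge[of 0 normal_index] by simp
  ultimately show "0 < x $ normal_index" using xW \<Psi>_\<Phi>[OF x] by force
qed

lemma flat_coordinates: "flat_coordinates (U c) (W c) (\<Phi> c) (\<Psi> c) (g c)"
proof
  show "C_k_on k (U c) (\<Phi> c)" for k
    using smooth_\<Phi> open_U by (rule smooth_on_imp_C_k_on) (simp add: U_def)
  show "C_k_on k (W c) (\<Psi> c)" for k
    using smooth_\<Psi> open_W by (rule smooth_on_imp_C_k_on) (simp add: W_def)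
  show "\<Phi> c x \<in> W c" if "x \<in> U c" for x
    using that \<Phi>_in interior_iff by (auto simp: U_def W_def)
  show "\<Psi> c z \<in> U c" if "z \<in> W c" for z
    using that \<Psi>_in interior_iff[OF \<Psi>_in] \<Phi>_\<Psi> by (auto simp: U_def W_def)
  show "g c x $ i $ j = partial_deriv (U c) i (\<Phi> c) x \<bullet> partial_deriv (U c) j (\<Phi> c) x" if x: "x \<in> U c" for x i j
  proof -
    have "partial_deriv (chart_image c) i (\<Phi> c) x = partial_deriv (U c) i (\<Phi> c) x" for i
      using open_U x by (rule partial_deriv_cong_open) (simp_all add: U_def)
    moreover have "x \<in> chart_image c" using x by (simp add: U_def)
    ultimately show ?thesis
      using riemannian_isometryD(4)[OF isometry c, of x i j]
      by (simp add: inter_topspace chart_image_def[symmetric] \<Phi>_def[symmetric])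
  qed
  show "open (U c)" "open (W c)" by (rule open_U open_W)+
  show "\<Psi> c (\<Phi> c x) = x" if "x \<in> U c" for x using that by (simp add: U_def \<Psi>_\<Phi>)
  show "\<Phi> c (\<Psi> c z) = z" if "z \<in> W c" for z using that by (simp add: W_def \<Phi>_\<Psi>)
qed

lemma boundary_chart:
  assumes p: "p \<in> fst c"
  shows "F p \<in> sphere z0 \<rho> \<longleftrightarrow> snd c p $ normal_index = 0"
proof -
  have x: "snd c p \<in> chart_image c" using p by (simp add: chart_image_def)
  then have "0 \<le> snd c p $ normal_index" using chart_image_half_space by (auto simp: half_space_def)
  moreover have "\<Phi> c (snd c p) = F p" by (simp add: \<Phi>_def chart_inv_chart[OF p])
  moreover have "F p \<in> cball z0 \<rho>" using imageI[OF subsetD[OF chart_domain p], of F] unfolding F_image .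
  ultimately show ?thesis using interior_iff[OF x] by (auto simp: less_le)
qed

end

text \<open>\<open>manifold_boundary\<close> asks for some chart with vanishing normal coordinate.
  As the sphere does not refer to charts, every chart gives the same answer.\<close>

lemma mem_boundary_iff:
  assumes p: "p \<in> topspace X"
  shows "p \<in> manifold_boundary X A \<longleftrightarrow> F p \<in> sphere z0 \<rho>"
  using chart_cover[OF p] boundary_chart p unfolding manifold_boundary_def by blast

lemma boundary_in_chart:
  assumes c: "c \<in> A"
  shows "snd c ` (fst c \<inter> manifold_boundary X A) = {x \<in> chart_image c. x $ normal_index = 0}"
proof -
  have "p \<in> manifold_boundary X A \<longleftrightarrow> snd c p $ normal_index = 0" if "p \<in> fst c" for p
    using that mem_boundary_iff boundary_chart[OF c that] chart_domain[OF c] by blast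
  then show ?thesis unfolding chart_image_def by blast
qed

end

section \<open>Critical metrics on a Euclidean ball\<close>

context ball_isometry
begin

lemma critical_metric_hessian:
  assumes crit: "miao_tam_critical_metric X A g f" and c: "c \<in> A" and x: "x \<in> U c"
  shows "CARD('n) \<noteq> 1"
    and "hessian (U c) (g c) (f \<circ> chart_inv c) i j x = - 1 / (real CARD('n) - 1) * g c x $ i $ j"
proof -
  interpret flat: flat_coordinates "U c" "W c" "\<Phi> c" "\<Psi> c" "g c"
    using c by (rule flat_coordinates)
  let ?h = "f \<circ> chart_inv c" and ?n = "real CARD('n)"
  let ?H = "\<lambda>i j. hessian (U c) (g c) ?h i j x"
  define L where "L = laplacian (chart_image c) (g c) ?h x"
  have sub: "U c \<subseteq> chart_image c" by (simp add: U_def)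
  note hess_eq = hessian_open_subset[OF flat.open_U sub x]
  have eq: "- L * g c x $ i $ j + ?H i j = g c x $ i $ j" for i j
  proof -
    have "- L * g c x $ i $ j + hessian (chart_image c) (g c) ?h i j x
        - f (chart_inv c x) * ricci (chart_image c) (g c) i j x = g c x $ i $ j"
      using crit c x sub unfolding miao_tam_critical_metric_def L_def by blast
    then show ?thesis
      by (simp add: hess_eq ricci_open_subset[OF flat.open_U sub x] flat.ricci_eq_0[OF x])
  qed
  have H: "?H i j = (1 + L) * g c x $ i $ j" for i j
    using eq[of i j] by (simp add: distrib_right)
  have sym: "transpose (g c x) = g c x"
    using x sub c crit unfolding miao_tam_critical_metric_def riemannian_metric_def by blast
  \<comment> \<open>\<open>L\<close> is itself the trace of the Hessian, so tracing \<open>H\<close>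
    gives a linear equation for \<open>L\<close>.\<close>
  have "L = (\<Sum>i\<in>UNIV. \<Sum>j\<in>UNIV. matrix_inv (g c x) $ i $ j * ((1 + L) * g c x $ i $ j))"
    unfolding L_def[symmetric] H[symmetric] hess_eq[symmetric] unfolding L_def laplacian_def by simp
  also have "\<dots> = (1 + L) * (\<Sum>i\<in>UNIV. \<Sum>j\<in>UNIV. matrix_inv (g c x) $ i $ j * g c x $ i $ j)"
    by (simp add: sum_distrib_left mult.left_commute)
  finally have L: "L = (1 + L) * ?n"
    using trace_matrix_inv[OF flat.matrix_inv_G[OF x] sym] by simp
  \<comment> \<open>In dimension one the equation reads \<open>L = 1 + L\<close>.\<close>
  then show card: "CARD('n) \<noteq> 1" by auto
  have "1 + L = - 1 / (?n - 1)" using L card by (simp add: field_simps)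
  then show "?H i j = - 1 / (?n - 1) * g c x $ i $ j" using H by simp
qed

text \<open>The contradiction in dimension one arises at an interior point; the preimage of the
  centre is one.\<close>

lemma critical_metric_dimension:
  assumes crit: "miao_tam_critical_metric X A g f"
  shows "2 \<le> CARD('n)"
proof -
  have z: "z0 \<in> cball z0 \<rho>" using radius_pos by simp
  obtain c where c: "c \<in> A" "Finv z0 \<in> fst c" using chart_cover[OF Finv_in[OF z]] by blast
  have "z0 \<in> W c" using F_Finv[OF z] c radius_pos by (auto simp: W_def intro: rev_image_eqI)
  then have "\<Psi> c z0 \<in> U c" using flat_coordinates.\<Psi>_in[OF flat_coordinates[OF c(1)]] by blast
  then have "CARD('n) \<noteq> 1" using critical_metric_hessian(1)[OF crit c(1)] by blast
  moreover have "0 < CARD('n)" by simp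
  ultimately show ?thesis by linarith
qed

lemma continuous_on_potential:
  assumes f: "smooth_function A f"
  shows "continuous_on (cball z0 \<rho>) (\<lambda>z. f (Finv z))"
  unfolding continuous_on_eq_continuous_within
proof
  fix z assume z: "z \<in> cball z0 \<rho>"
  obtain c where c: "c \<in> A" "Finv z \<in> fst c" using chart_cover[OF Finv_in[OF z]] by blast
  obtain O' where O': "open O'" "F ` fst c = O' \<inter> cball z0 \<rho>" by (rule F_chart_open[OF c(1)])
  have "z \<in> F ` fst c" using F_Finv[OF z] c(2) by (auto intro: rev_image_eqI)
  have "continuous_on (F ` fst c) (\<lambda>z. (f \<circ> chart_inv c) (\<Psi> c z))"
  proof (rule continuous_on_compose2[of "chart_image c" "f \<circ> chart_inv c" "F ` fst c" "\<Psi> c"])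
    show "continuous_on (F ` fst c) (\<Psi> c)"
      using smooth_\<Psi>[OF c(1)] by (rule smooth_on_imp_continuous_on)
    show "continuous_on (chart_image c) (f \<circ> chart_inv c)"
      by (rule smooth_on_imp_continuous_on) (use f c(1) in \<open>simp add: smooth_function_def\<close>)
    show "\<Psi> c ` F ` fst c \<subseteq> chart_image c" using \<Psi>_in[OF c(1)] by blast
  qed
  then have "continuous_on (F ` fst c) (\<lambda>z. f (Finv z))"
    by (rule continuous_on_eq) (simp add: chart_inv_\<Psi>[OF c(1)])
  then have "continuous (at z within F ` fst c) (\<lambda>z. f (Finv z))"
    using \<open>z \<in> F ` fst c\<close> unfolding continuous_on_eq_continuous_within by (rule bspec)
  moreover have "at z within F ` fst c = at z within cball z0 \<rho>"
    using O' \<open>z \<in> F ` fst c\<close> by (intro at_within_nhd[of z O']) auto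
  ultimately show "continuous (at z within cball z0 \<rho>) (\<lambda>z. f (Finv z))" by simp
qed

text \<open>The flat critical potential is \<open>(\<rho>\<^sup>2 - |z - z0|\<^sup>2) / (2 (n - 1))\<close>; only its value at the
  centre is needed.\<close>

lemma critical_potential_center:
  assumes crit: "miao_tam_critical_metric X A g f"
  shows "f (Finv z0) = \<rho>\<^sup>2 / (2 * (real CARD('n) - 1))"
proof -
  let ?\<mu> = "- 1 / (real CARD('n) - 1)"
  \<comment> \<open>Any coordinate direction will do: the diameter along it joins two boundary
    points through the centre.\<close>
  define m :: 'n where "m = undefined"
  define \<phi> where "\<phi> t = f (Finv (z0 + t *\<^sub>R axis m 1))" for t
  have smooth: "smooth_function A f"
    using crit by (simp add: miao_tam_critical_metric_def)
  have "\<phi> 0 = - ?\<mu> * \<rho>\<^sup>2 / 2"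
  proof (rule constant_second_derivative_midpoint[OF radius_pos])
    show "continuous_on {- \<rho>..\<rho>} \<phi>"
      unfolding \<phi>_def[abs_def]
      by (rule continuous_on_compose2[OF continuous_on_potential[OF smooth]])
        (auto intro!: continuous_intros simp: dist_norm norm_axis_1)
    have zero: "\<phi> t = 0" if "\<bar>t\<bar> = \<rho>" for t
    proof -
      have z: "z0 + t *\<^sub>R axis m 1 \<in> cball z0 \<rho>" "z0 + t *\<^sub>R axis m 1 \<in> sphere z0 \<rho>"
        using that by (simp_all add: dist_norm norm_axis_1)
      then have "Finv (z0 + t *\<^sub>R axis m 1) \<in> manifold_boundary X A"
        using mem_boundary_iff[OF Finv_in[OF z(1)]] F_Finv[OF z(1)] by simp
      then show ?thesis using crit unfolding \<phi>_def miao_tam_critical_metric_def by blast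
    qed
    show "\<phi> (- \<rho>) = 0" "\<phi> \<rho> = 0" using radius_pos by (auto intro!: zero)
  next
    fix t :: real assume t: "- \<rho> < t" "t < \<rho>"
    define z where "z = z0 + t *\<^sub>R axis m 1"
    have zK: "z \<in> cball z0 \<rho>" and zB: "z \<in> ball z0 \<rho>"
      using t by (auto simp: z_def dist_norm norm_axis_1)
    obtain c where c: "c \<in> A" "Finv z \<in> fst c" using chart_cover[OF Finv_in[OF zK]] by blast
    interpret flat: flat_coordinates "U c" "W c" "\<Phi> c" "\<Psi> c" "g c"
      using c(1) by (rule flat_coordinates)
    have zW: "z0 + t *\<^sub>R axis m 1 \<in> W c"
      unfolding z_def[symmetric] using F_Finv[OF zK] c zB by (auto simp: W_def intro: rev_image_eqI)
    have h: "C_k_on k (U c) (f \<circ> chart_inv c)" for k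
      by (rule smooth_on_imp_C_k_on[OF _ flat.open_U])
        (use smooth c(1) in \<open>auto simp: smooth_function_def U_def\<close>)
    obtain \<phi>' where \<phi>': "\<forall>\<^sub>F s in nhds t.
        ((\<lambda>s. (f \<circ> chart_inv c) (\<Psi> c (z0 + s *\<^sub>R axis m 1))) has_real_derivative \<phi>' s) (at s)"
      "(\<phi>' has_real_derivative ?\<mu>) (at t)"
      using flat.second_derivative_along_line[OF h critical_metric_hessian(2)[OF crit c(1)] zW] by blast
    have agree: "(f \<circ> chart_inv c) (\<Psi> c (z0 + s *\<^sub>R axis m 1)) = \<phi> s" if "z0 + s *\<^sub>R axis m 1 \<in> W c" for s
      using that by (simp add: \<phi>_def W_def chart_inv_\<Psi>[OF c(1)])
    have "\<forall>\<^sub>F s in nhds t. z0 + s *\<^sub>R axis m 1 \<in> W c"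
      using flat.open_W zW by (rule eventually_line_in_open)
    with \<phi>'(1) have "\<forall>\<^sub>F s in nhds t. (\<phi> has_real_derivative \<phi>' s) (at s)"
    proof eventually_elim
      case (elim s)
      \<comment> \<open>Transferring the derivative at \<open>s\<close> requires agreement on a
        neighbourhood of \<open>s\<close> itself.\<close>
      have "\<forall>\<^sub>F s in nhds s. z0 + s *\<^sub>R axis m 1 \<in> W c"
        using flat.open_W elim(2) by (rule eventually_line_in_open)
      then have "\<forall>\<^sub>F s in nhds s. (f \<circ> chart_inv c) (\<Psi> c (z0 + s *\<^sub>R axis m 1)) = \<phi> s"
        by (rule eventually_mono) (rule agree)
      from DERIV_cong_ev[OF refl this refl] elim(1) show ?case by blast
    qed
    with \<phi>'(2) show "\<exists>\<phi>'. (\<forall>\<^sub>F s in nhds t. (\<phi> has_real_derivative \<phi>' s) (at s)) \<and>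
        (\<phi>' has_real_derivative ?\<mu>) (at t)" by blast
  qed
  then show ?thesis by (simp add: \<phi>_def)
qed

text \<open>In chart coordinates both \<open>F\<close> and \<open>B\<close> reproduce the components
  of \<open>g\<close> in the tangential indices, so the two images of one boundary curve have the
  same speed.\<close>

lemma boundary_isometry_speed:
  assumes iso: "riemannian_isometry X A g (manifold_boundary X A) (UNIV - {normal_index}) N B"
    and \<sigma>: "\<And>t. \<sigma> t \<in> sphere z0 \<rho>" and \<sigma>': "(\<sigma> has_vector_derivative \<sigma>') (at t0)"
  shows "\<exists>d. ((\<lambda>t. B (Finv (\<sigma> t))) has_vector_derivative d) (at t0) \<and> norm d = norm \<sigma>'"
proof -
  have \<sigma>K: "\<sigma> t \<in> cball z0 \<rho>" for t using \<sigma>[of t] by simp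
  have bdry: "Finv (\<sigma> t) \<in> manifold_boundary X A" for t
    using mem_boundary_iff[OF Finv_in[OF \<sigma>K]] F_Finv[OF \<sigma>K] \<sigma> by simp
  obtain c where c: "c \<in> A" "Finv (\<sigma> t0) \<in> fst c" using chart_cover[OF Finv_in[OF \<sigma>K]] by blast
  define S where "S = chart_image c"
  define T where "T = snd c ` (fst c \<inter> manifold_boundary X A)"
  have T: "T = {x \<in> S. x $ normal_index = 0}"
    unfolding T_def S_def using c(1) by (rule boundary_in_chart)
  obtain O' where O': "open O'" "F ` fst c = O' \<inter> cball z0 \<rho>" by (rule F_chart_open[OF c(1)])
  have "\<sigma> t0 \<in> F ` fst c" using F_Finv[OF \<sigma>K, of t0] c(2) by (metis imageI)
  then have "\<sigma> t0 \<in> O'" using O'(2) by blast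
  have "isCont \<sigma> t0" using \<sigma>' by (rule has_vector_derivative_continuous)
  then have "\<forall>\<^sub>F t in nhds t0. \<sigma> t \<in> O'"
    using O'(1) \<open>\<sigma> t0 \<in> O'\<close> by (rule isCont_eventually_in_open)
  then have ev: "\<forall>\<^sub>F t in nhds t0. \<sigma> t \<in> F ` fst c"
    by (rule eventually_mono) (use O'(2) \<sigma>K in blast)
  define y where "y t = \<Psi> c (\<sigma> t)" for t
  obtain y' where "((\<lambda>t. \<Psi> c (\<sigma> t)) has_vector_derivative y') (at t0)"
    by (rule smooth_on_curve_extension[OF smooth_\<Psi>[OF c(1)] ev \<sigma>'], rule that)
  then have y': "(y has_vector_derivative y') (at t0)" unfolding y_def[abs_def] .
  have Finv_chart: "Finv (\<sigma> t) \<in> fst c" if "\<sigma> t \<in> F ` fst c" for t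
    using that Finv_F chart_domain[OF c(1)] by force
  have yT_if: "y t \<in> T" if "\<sigma> t \<in> F ` fst c" for t
    unfolding y_def \<Psi>_def T_def using Finv_chart[OF that] bdry by simp
  have yT: "\<forall>\<^sub>F t in nhds t0. y t \<in> T" using ev by (rule eventually_mono) (rule yT_if)
  then have yS: "\<forall>\<^sub>F t in nhds t0. y t \<in> S" by (rule eventually_mono) (simp add: T)
  have y0: "y t0 \<in> T" using yT by (rule eventually_nhds_x_imp_x)
  \<comment> \<open>The normal coordinate is constantly zero along the curve, so the velocity is
    tangential, as \<open>smooth_on_curve\<close> and \<open>norm_sum_scaleR_eq\<close>
    require.\<close>
  have "((\<lambda>t. y t $ normal_index) has_vector_derivative y' $ normal_index) (at t0)"
    using y' by (rule bounded_linear.has_vector_derivative[OF bounded_linear_vec_nth])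
  moreover have "\<forall>\<^sub>F t in nhds t0. y t $ normal_index = 0"
    using yT by (rule eventually_mono) (simp add: T)
  ultimately have "((\<lambda>t. 0) has_vector_derivative y' $ normal_index) (at t0)"
    by (rule has_vector_derivative_transform_eventually)
  then have normal: "y' $ normal_index = 0"
    using vector_derivative_unique_at has_vector_derivative_const by blast
  have lineT: "\<forall>\<^sub>F t in nhds 0. y t0 + t *\<^sub>R axis i 1 \<in> T" if "i \<noteq> normal_index" for i
  proof -
    obtain V where V: "open V" "chart_image c = V \<inter> half_space" by (rule chart_image_open[OF c(1)])
    have "\<forall>\<^sub>F t in nhds 0. y t0 + t *\<^sub>R axis i 1 \<in> V"
      using V y0 by (intro eventually_line_in_open) (auto simp: T S_def)
    then show ?thesis
      by (rule eventually_mono) (use y0 that in \<open>auto simp: T S_def V(2) half_space_def axis_def\<close>)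
  qed
  have lineS: "\<forall>\<^sub>F t in nhds 0. y t0 + t *\<^sub>R axis i 1 \<in> S" if "i \<noteq> normal_index" for i
    using lineT[OF that] by (rule eventually_mono) (simp add: T)
  have ne: "i \<noteq> normal_index" if "y' $ i \<noteq> 0" for i using that normal by auto
  define a where "a i = partial_deriv S i (\<Phi> c) (y t0)" for i
  define b where "b i = partial_deriv T i (B \<circ> chart_inv c) (y t0)" for i
  have "((\<lambda>t. \<Phi> c (y t)) has_vector_derivative (\<Sum>i\<in>UNIV. y' $ i *\<^sub>R a i)) (at t0)"
    unfolding a_def
    by (rule smooth_on_curve[OF smooth_\<Phi>[OF c(1), folded S_def] yS y']) (intro lineS ne)
  moreover have "\<forall>\<^sub>F t in nhds t0. \<Phi> c (y t) = \<sigma> t"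
    using ev unfolding y_def by (rule eventually_mono) (rule \<Phi>_\<Psi>[OF c(1)])
  ultimately have "(\<sigma> has_vector_derivative (\<Sum>i\<in>UNIV. y' $ i *\<^sub>R a i)) (at t0)"
    by (rule has_vector_derivative_transform_eventually)
  then have a: "(\<Sum>i\<in>UNIV. y' $ i *\<^sub>R a i) = \<sigma>'" using \<sigma>' by (rule vector_derivative_unique_at)
  have "((\<lambda>t. (B \<circ> chart_inv c) (y t)) has_vector_derivative (\<Sum>i\<in>UNIV. y' $ i *\<^sub>R b i)) (at t0)"
    unfolding b_def
    by (rule smooth_on_curve[OF riemannian_isometryD(2)[OF iso c(1), folded T_def] yT y']) (intro lineT ne)
  moreover have "\<forall>\<^sub>F t in nhds t0. (B \<circ> chart_inv c) (y t) = B (Finv (\<sigma> t))"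
    using ev unfolding y_def by (rule eventually_mono) (simp add: chart_inv_\<Psi>[OF c(1)])
  ultimately have d: "((\<lambda>t. B (Finv (\<sigma> t))) has_vector_derivative (\<Sum>i\<in>UNIV. y' $ i *\<^sub>R b i)) (at t0)"
    by (rule has_vector_derivative_transform_eventually)
  have "norm (\<Sum>i\<in>UNIV. y' $ i *\<^sub>R b i) = norm (\<Sum>i\<in>UNIV. y' $ i *\<^sub>R a i)"
  proof (rule norm_sum_scaleR_eq)
    fix i j :: 'n assume ij: "i \<in> UNIV - {normal_index}" "j \<in> UNIV - {normal_index}"
    have "b i \<bullet> b j = g c (y t0) $ i $ j"
      unfolding b_def T_def using riemannian_isometryD(4)[OF iso c(1) _ ij] y0 by (simp add: T_def)
    moreover have "a i \<bullet> a j = g c (y t0) $ i $ j"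
      using riemannian_isometryD(4)[OF isometry c(1), of "y t0" i j] y0
      by (simp add: inter_topspace[OF c(1)] chart_image_def[symmetric] \<Phi>_def[symmetric] a_def S_def T)
    ultimately show "b i \<bullet> b j = a i \<bullet> a j" by simp
  qed (use normal in auto)
  with d a show ?thesis by auto
qed

lemma boundary_sphere_radius_le:
  assumes dim: "2 \<le> CARD('n)" and r: "0 < r"
    and iso: "boundary_isometric_to X A g (sphere (0 :: real^'n) r)"
  shows "r \<le> \<rho>"
proof -
  obtain B where B: "riemannian_isometry X A g (manifold_boundary X A) (UNIV - {normal_index}) (sphere 0 r) B"
    using iso by (auto simp: boundary_isometric_to_def)
  have sub: "manifold_boundary X A \<subseteq> topspace X" by (auto simp: manifold_boundary_def)
  have B_image: "B ` manifold_boundary X A = sphere 0 r"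
    using homeomorphic_imp_surjective_map[OF riemannian_isometryD(1)[OF B]] sub
    by (simp add: inf.absorb2)
  \<comment> \<open>Antipodal in the sphere of radius \<open>r\<close>, where a lower bound on
    length is wanted; the corresponding points of the other sphere may lie anywhere on it.\<close>
  define q :: "real^'n" where "q = r *\<^sub>R axis undefined 1"
  have "q \<in> sphere 0 r" "- q \<in> sphere 0 r" using r by (simp_all add: q_def norm_axis_1)
  then obtain p1 p2 where p: "p1 \<in> manifold_boundary X A" "B p1 = q" "p2 \<in> manifold_boundary X A" "B p2 = - q"
    using B_image by (metis imageE)
  define u where "u = (F p1 - z0) /\<^sub>R \<rho>"
  define v where "v = (F p2 - z0) /\<^sub>R \<rho>"
  have unit: "norm u = 1" "norm v = 1"
    using mem_boundary_iff p sub radius_pos by (auto simp: u_def v_def dist_norm norm_minus_commute)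
  have "2 \<le> DIM(real^'n)" using dim by simp
  then obtain w \<alpha> where w: "norm w = 1" "u \<bullet> w = 0" and \<alpha>: "0 \<le> \<alpha>" "\<alpha> \<le> pi"
    and v_eq: "v = cos \<alpha> *\<^sub>R u + sin \<alpha> *\<^sub>R w"
    using unit by (rule unit_vector_on_great_circle)
  have inner: "u \<bullet> u = 1" "w \<bullet> w = 1" "w \<bullet> u = 0" using unit w by (simp_all add: norm_eq_1 inner_commute)
  have circle: "norm (a *\<^sub>R u + b *\<^sub>R w) = 1" if "a\<^sup>2 + b\<^sup>2 = 1" for a b
    using that by (simp add: norm_eq_1 inner_add_left inner_add_right inner w power2_eq_square)
  \<comment> \<open>The whole great circle, since \<open>antipodal_arc_length\<close> asks for a
    curve on all of the reals; its speed is \<open>\<rho>\<close>.\<close>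
  define \<sigma> where "\<sigma> t = z0 + \<rho> *\<^sub>R (cos t *\<^sub>R u + sin t *\<^sub>R w)" for t
  have \<sigma>: "\<sigma> t \<in> sphere z0 \<rho>" for t
    using circle[of "cos t" "sin t"] radius_pos by (simp add: \<sigma>_def dist_norm)
  have \<sigma>': "(\<sigma> has_vector_derivative \<rho> *\<^sub>R ((- sin t) *\<^sub>R u + cos t *\<^sub>R w)) (at t)" for t
    unfolding \<sigma>_def[abs_def] by (auto intro!: derivative_eq_intros)
  define \<gamma> where "\<gamma> t = B (Finv (\<sigma> t))" for t
  have "\<exists>d. (\<gamma> has_vector_derivative d) (at t) \<and> norm d = \<rho>" for t
    using boundary_isometry_speed[OF B \<sigma> \<sigma>'[of t]] circle[of "- sin t" "cos t"] radius_pos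
    unfolding \<gamma>_def[abs_def] by simp
  then obtain \<gamma>' where \<gamma>': "\<And>t. (\<gamma> has_vector_derivative \<gamma>' t) (at t)" "\<And>t. norm (\<gamma>' t) = \<rho>"
    by metis
  have "norm (\<gamma> t) = r" for t
  proof -
    have K: "\<sigma> t \<in> cball z0 \<rho>" using \<sigma>[of t] by simp
    have "Finv (\<sigma> t) \<in> manifold_boundary X A"
      using mem_boundary_iff[OF Finv_in[OF K]] F_Finv[OF K] \<sigma> by simp
    then have "\<gamma> t \<in> sphere 0 r" unfolding \<gamma>_def using B_image by blast
    then show ?thesis by simp
  qed
  moreover have "\<sigma> 0 = F p1" "\<sigma> \<alpha> = F p2"
    using radius_pos unfolding \<sigma>_def v_eq[symmetric] by (simp_all add: u_def v_def)
  then have "\<gamma> \<alpha> = - \<gamma> 0"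
    using p Finv_F[OF subsetD[OF sub p(1)]] Finv_F[OF subsetD[OF sub p(3)]] by (simp add: \<gamma>_def)
  ultimately have "pi * r \<le> \<rho> * \<alpha>"
    using \<gamma>' by (intro antipodal_arc_length[OF r \<alpha>(1), of \<gamma> \<gamma>']) auto
  also have "\<dots> \<le> \<rho> * pi" using \<alpha> radius_pos by (intro mult_left_mono) auto
  finally show ?thesis by (simp add: mult.commute)
qed

end

theorem corollary2:
  fixes X :: "'a topology"
    and A :: "('a, 'n::finite) chart set"
    and g :: "('a, 'n) metric"
    and f :: "'a \<Rightarrow> real"
    and r fmax :: real
  assumes "miao_tam_critical_metric X A g f"
    and "zero_scalar_curvature A g"
    and "0 < r"
    and "boundary_isometric_to X A g (sphere (0 :: real^'n) r)"
    and "fmax \<in> f ` topspace X" and "\<And>p. p \<in> topspace X \<Longrightarrow> f p \<le> fmax"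
    and "r > sqrt (2 * (real CARD('n) - 1) * fmax)"
  shows "\<not> (\<exists>(c :: real^'n) \<rho>. 0 < \<rho> \<and> isometric_to X A g (cball c \<rho>))"
proof
  assume "\<exists>(c :: real^'n) \<rho>. 0 < \<rho> \<and> isometric_to X A g (cball c \<rho>)"
  then obtain z0 :: "real^'n" and \<rho> F where \<rho>: "0 < \<rho>"
    and F: "riemannian_isometry X A g (topspace X) UNIV (cball z0 \<rho>) F"
    by (auto simp: isometric_to_def)
  interpret ball_isometry X A g F z0 \<rho>
    using assms(1) \<rho> F by unfold_locales (simp_all add: miao_tam_critical_metric_def)
  have n: "2 \<le> CARD('n)" using assms(1) by (rule critical_metric_dimension)
  \<comment> \<open>The left side is the value at the centre. With \<open>n\<close> making the
    denominator positive, this turns the hypothesis on \<open>r\<close> into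
    \<open>\<rho> < r\<close>.\<close>
  have "\<rho>\<^sup>2 / (2 * (real CARD('n) - 1)) \<le> fmax"
    using assms(6)[OF Finv_in[of z0]] \<rho> by (simp add: critical_potential_center[OF assms(1)])
  then have "\<rho>\<^sup>2 \<le> 2 * (real CARD('n) - 1) * fmax"
    using n by (simp add: field_simps)
  then have "\<rho> \<le> sqrt (2 * (real CARD('n) - 1) * fmax)" by (rule real_le_rsqrt)
  also have "\<dots> < r" by (rule assms(7))
  also have "r \<le> \<rho>" using n assms(3,4) by (rule boundary_sphere_radius_le)
  finally show False by simp
qed

end
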